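(* Let $G_1=(V^{(1)},E^{(1)},w^{(1)},\kappa^{(1)})$ be a weighted tree and $G_2=(V^{(2)},E^{(2)},w^{(2)},\kappa^{(2)})$ a weighted bipartite graph, with $\kappa^{(1)}\geq 0$, $\kappa^{(2)}\geq 0$, $|V^{(1)}|=n_1$, $|V^{(2)}|=n_2$. Let $G=(V,E,w,\kappa)$ be the product graph of $G_1$ and $G_2$. Let $\{\lambda_i\}_{i=1}^{n_1n_2}$, $\{\lambda^{(1)}_i\}_{i=1}^{n_1}$, $\{\lambda^{(2)}_i\}_{i=1}^{n_2}$ be the eigenvalues of the Laplacians of $G$, $G_1$, $G_2$ respectively, in ascending order. If $1\le k\le n_1-1$ and $\lambda^{(2)}_{n_2}<\lambda^{(1)}_{k+1}-\lambda^{(1)}_k$, then $$\rho_{kn_2}(G)\leq\sqrt{2\tau_G\lambda_{kn_2}}.$$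
   Context: All graphs are finite simple without isolated vertices, with vertex measure $\mu\equiv 1$, so a weighted graph is $(V,E,w,\kappa)$ with $w:E\to\mathbb{R}_{>0}$, $\kappa:V\to\mathbb{R}$. Its Laplacian is $L=D+K-A$, where $A$ is the weighted adjacency matrix ($a_{ij}=w_{ij}$ if $i\sim j$, else $0$), $D=\mathrm{diag}(d(i))$ with $d(i)=\sum_{j\sim i}w_{ij}$, $K=\mathrm{diag}(\kappa_i)$; $\tau_G=\max_i d(i)$. The product of $G_1$ and $G_2$ has vertex set $V^{(1)}\times V^{(2)}$, with $(x,y)\sim(x',y')$ iff ($x=x'$ and $y\sim y'$) or ($x\sim x'$ and $y=y'$), weights $w_{(x,y),(x,y')}=w^{(2)}_{yy'}$, $w_{(x,y),(x',y)}=w^{(1)}_{xx'}$, and potential $\kappa_{(x,y)}=\kappa^{(1)}_x+\kappa^{(2)}_y$. For $\emptyset\neq S\subset V$, $\Phi_G(S)=\frac{\sum_{i\in S,j\notin S}w_{ij}}{|S|}$, and $\rho_m(G)=\min\max_{1\leq i\leq m}\Phi_G(A_i)$ over all $m$-tuples of nonempty pairwise disjoint subsets of $V$. *)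

theory Defs
  imports "HOL-Analysis.Analysis" "HOL-Computational_Algebra.Polynomial"
begin

section \<open>Weighted graphs\<close>

text \<open>
  The vertex set is the finite type \<open>'a\<close> itself. Values of \<open>wt\<close> on non-adjacent pairs
  carry no meaning: every definition below reads \<open>wt\<close> on adjacent pairs only.
\<close>

record 'a wgraph =
  adj :: "'a \<Rightarrow> 'a \<Rightarrow> bool"
  wt :: "'a \<Rightarrow> 'a \<Rightarrow> real"
  pot :: "'a \<Rightarrow> real"

definition weighted_graph :: "'a::finite wgraph \<Rightarrow> bool" where
  "weighted_graph G \<longleftrightarrow>
     irreflp (adj G) \<and> symp (adj G) \<and>
     (\<forall>x. \<exists>y. adj G x y) \<and>
     (\<forall>x y. adj G x y \<longrightarrow> wt G x y > 0 \<and> wt G x y = wt G y x)"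

definition connected_graph :: "'a::finite wgraph \<Rightarrow> bool" where
  "connected_graph G \<longleftrightarrow> (\<forall>x y. (adj G)\<^sup>*\<^sup>* x y)"

text \<open>
  The bound on the length excludes the closed walks \<open>x, y, x\<close>, which are not cycles of an
  undirected graph.
\<close>

definition graph_cycle :: "'a::finite wgraph \<Rightarrow> 'a list \<Rightarrow> bool" where
  "graph_cycle G c \<longleftrightarrow>
     length c \<ge> 3 \<and> distinct c \<and> successively (adj G) c \<and> adj G (last c) (hd c)"

definition weighted_tree :: "'a::finite wgraph \<Rightarrow> bool" where
  "weighted_tree G \<longleftrightarrow>
     weighted_graph G \<and> connected_graph G \<and> (\<nexists>c. graph_cycle G c)"

definition weighted_bipartite_graph :: "'a::finite wgraph \<Rightarrow> bool" where
  "weighted_bipartite_graph G \<longleftrightarrow>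
     weighted_graph G \<and>
     (\<exists>A B. A \<union> B = UNIV \<and> A \<inter> B = {} \<and>
        (\<forall>x y. adj G x y \<longrightarrow> (x \<in> A \<and> y \<in> B) \<or> (x \<in> B \<and> y \<in> A)))"

definition product_graph :: "'a::finite wgraph \<Rightarrow> 'b::finite wgraph \<Rightarrow> ('a \<times> 'b) wgraph" where
  "product_graph G1 G2 =
     \<lparr> adj = (\<lambda>(x, y) (x', y'). (x = x' \<and> adj G2 y y') \<or> (adj G1 x x' \<and> y = y')),
       wt = (\<lambda>(x, y) (x', y'). if x = x' then wt G2 y y' else wt G1 x x'),
       pot = (\<lambda>(x, y). pot G1 x + pot G2 y) \<rparr>"

lemma weighted_graph_product_graph:
  assumes "weighted_graph G1" "weighted_graph G2"
  shows "weighted_graph (product_graph G1 G2)"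
  using assms
  by (fastforce simp: weighted_graph_def product_graph_def irreflp_on_def symp_on_def)

section \<open>Laplacian and spectrum\<close>

definition wdegree :: "'a::finite wgraph \<Rightarrow> 'a \<Rightarrow> real" where
  "wdegree G x = (\<Sum>y | adj G x y. wt G x y)"

definition max_wdegree :: "'a::finite wgraph \<Rightarrow> real" where
  "max_wdegree G = Max (range (wdegree G))"

definition diag_matrix :: "('n::finite \<Rightarrow> real) \<Rightarrow> real^'n^'n" where
  "diag_matrix d = (\<chi> i j. if i = j then d i else 0)"

definition adj_matrix :: "'a::finite wgraph \<Rightarrow> real^'a^'a" where
  "adj_matrix G = (\<chi> i j. if adj G i j then wt G i j else 0)"

definition laplacian :: "'a::finite wgraph \<Rightarrow> real^'a^'a" where
  "laplacian G = diag_matrix (wdegree G) + diag_matrix (pot G) - adj_matrix G"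

definition charpoly :: "real^'n::finite^'n \<Rightarrow> real poly" where
  "charpoly A = det (mat [:0, 1:] - map_matrix (\<lambda>a. [:a:]) A)"

text \<open>
  Real eigenvalues with algebraic multiplicity. For a symmetric matrix, such as the Laplacian
  of a weighted graph, these are all eigenvalues, and the list has length \<open>CARD('n)\<close>.
\<close>

definition eigenvalue_list :: "real^'n::finite^'n \<Rightarrow> real list" where
  "eigenvalue_list A = sorted_list_of_multiset (proots (charpoly A))"

text \<open>Eigenvalues are numbered from 1, list positions from 0.\<close>

definition laplace_eigenvalue :: "'a::finite wgraph \<Rightarrow> nat \<Rightarrow> real" where
  "laplace_eigenvalue G i = eigenvalue_list (laplacian G) ! (i - 1)"

section \<open>Multi-way Cheeger constants\<close>

definition expansion :: "'a::finite wgraph \<Rightarrow> 'a set \<Rightarrow> real" where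
  "expansion G S = (\<Sum>i\<in>S. \<Sum>j | j \<notin> S \<and> adj G i j. wt G i j) / real (card S)"

text \<open>
  \<open>Min\<close> ranges over a finite set, since \<open>expansion G\<close> takes only finitely many values.
  For \<open>m = 0\<close> or \<open>m > CARD('a)\<close> the value is meaningless.
\<close>

definition multiway_cheeger :: "nat \<Rightarrow> 'a::finite wgraph \<Rightarrow> real" where
  "multiway_cheeger m G =
     Min {Max ((\<lambda>i. expansion G (A i)) ` {1..m}) | A.
            (\<forall>i\<in>{1..m}. A i \<noteq> {}) \<and> disjoint_family_on A {1..m}}"

end

(*
  Sets of the form S \<times> {y} have expansion \<Phi>(S) + d(y) in the product, so it suffices to find k
  disjoint subsets S of the tree with \<Phi>(S) \<le> sqrt (2 \<tau> \<lambda>), where \<lambda> is the k-th eigenvalue of the tree.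
  These are superlevel sets of the squares of k disjointly supported functions with Rayleigh quotient at most \<lambda>,
  obtained without nodal domains or genericity: cut off a minimal branch of the tree carrying such a
  function. Deleting its attaching vertex removes at most one dimension from the spectral subspace, and
  the rest of the branch carries none of it.
  The gap condition gives that the (k n)-th eigenvalue of the product is at least \<lambda> + \<mu>, with \<mu> the
  top eigenvalue of the other factor, and \<mu> is at least the maximal degree of that factor, since the
  diagonal entries of its Laplacian are. An elementary inequality combines the two contributions.
*)
theory Submission
  imports Defs
begin

section \<open>Spectral theorem for real symmetric matrices and its link to the characteristic
  polynomial\<close>

section \<open>Symmetric matrices\<close>

lemma symmetric_matrix_inner:
  fixes A :: "real^'n^'n"
  assumes "transpose A = A"
  shows "x \<bullet> (A *v y) = y \<bullet> (A *v x)"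
  by (metis assms dot_lmul_matrix inner_commute transpose_matrix_vector)

lemma matrix_form_scaleR: "(r *\<^sub>R x) \<bullet> (A *v (r *\<^sub>R x)) = r\<^sup>2 * (x \<bullet> (A *v x))"
  for A :: "real^'n^'n"
  by (simp add: matrix_vector_mult_scaleR power2_eq_square)

lemma matrix_form_add:
  fixes A :: "real^'n^'n"
  assumes "transpose A = A"
  shows "(x + y) \<bullet> (A *v (x + y)) = x \<bullet> (A *v x) + 2 * (x \<bullet> (A *v y)) + y \<bullet> (A *v y)"
  using symmetric_matrix_inner[OF assms, of x y]
  by (simp add: matrix_vector_right_distrib inner_add_left inner_add_right)

text \<open>First-order condition at an extremum: near \<open>t = 0\<close> the linear term
  dominates, so a nonzero \<open>b\<close> would make the expression negative for some
  \<open>t\<close>.\<close>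

lemma quadratic_nonneg_imp_linear_zero:
  fixes a b :: real
  assumes "\<And>t. 0 \<le> 2 * t * b + t\<^sup>2 * a"
  shows "b = 0"
proof (rule ccontr)
  assume b: "b \<noteq> 0"
  have a: "a \<ge> 0" using assms[of 1] assms[of "-1"] by simp
  \<comment> \<open>The parabola has its minimum at \<open>- b / a\<close>; the denominator
    \<open>a + 1\<close> also covers \<open>a = 0\<close>.\<close>
  define t where "t = - b / (a + 1)"
  have "2 * t * b + t\<^sup>2 * a = (b\<^sup>2 / (a + 1)) * (a / (a + 1) - 2)"
    using a unfolding t_def by (simp add: divide_simps power2_eq_square) (simp add: algebra_simps)
  moreover have "b\<^sup>2 / (a + 1) > 0" using a b by simp
  moreover have "a / (a + 1) < 2" using a by (simp add: divide_simps)
  ultimately have "2 * t * b + t\<^sup>2 * a < 0" by (metis diff_less_0_iff_less mult_pos_neg)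
  then show False using assms[of t] by simp
qed

text \<open>A maximizer of the Rayleigh quotient on the invariant subspace is an eigenvector.\<close>

lemma symmetric_matrix_eigenvector:
  fixes A :: "real^'n^'n"
  assumes sym: "transpose A = A" and S: "subspace S" and inv: "\<And>x. x \<in> S \<Longrightarrow> A *v x \<in> S"
    and nz: "S \<noteq> {0}"
  obtains v m where "v \<in> S" "norm v = 1" "A *v v = m *\<^sub>R v"
proof -
  obtain u where u: "u \<in> S" "u \<noteq> 0" using nz subspace_0[OF S] by blast
  let ?K = "S \<inter> sphere 0 1"
  have "compact ?K"
    using closed_Int_compact[OF closed_subspace[OF S] compact_sphere] .
  moreover have "(1 / norm u) *\<^sub>R u \<in> ?K"
    using u S by (simp add: subspace_scale)
  moreover have "continuous_on ?K (\<lambda>x. x \<bullet> (A *v x))"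
    by (intro continuous_intros)
  ultimately obtain v where v: "v \<in> ?K" "\<And>x. x \<in> ?K \<Longrightarrow> x \<bullet> (A *v x) \<le> v \<bullet> (A *v v)"
    using continuous_attains_sup[of ?K] by blast
  define m where "m = v \<bullet> (A *v v)"
  have vv: "v \<bullet> v = 1" using v(1) by (simp add: norm_eq_1)
  have bound: "x \<bullet> (A *v x) \<le> m * (x \<bullet> x)" if "x \<in> S" for x
  proof (cases "x = 0")
    case False
    have "(1 / norm x) *\<^sub>R x \<in> ?K" using that S False by (simp add: subspace_scale)
    from v(2)[OF this] have "(1 / norm x)\<^sup>2 * (x \<bullet> (A *v x)) \<le> m"
      unfolding m_def matrix_form_scaleR .
    then show ?thesis using False
      by (simp add: divide_simps dot_square_norm mult.commute split: if_splits)
  qed simp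
  \<comment> \<open>First variation of the Rayleigh quotient at \<open>v\<close> in the direction
    \<open>u\<close>. The residual lies in \<open>S\<close> itself, so orthogonality to all of
    \<open>S\<close> makes it vanish.\<close>
  have "u \<bullet> (m *\<^sub>R v - A *v v) = 0" if "u \<in> S" for u
  proof (rule quadratic_nonneg_imp_linear_zero)
    fix t :: real
    have "v + t *\<^sub>R u \<in> S" using v(1) that S by (simp add: subspace_add subspace_scale)
    from bound[OF this]
    show "0 \<le> 2 * t * (u \<bullet> (m *\<^sub>R v - A *v v)) + t\<^sup>2 * (m * (u \<bullet> u) - u \<bullet> (A *v u))"
      unfolding matrix_form_add[OF sym] matrix_form_scaleR
      using symmetric_matrix_inner[OF sym, of u v]
      by (simp add: m_def[symmetric] inner_add_left inner_add_right inner_diff_right vv inner_commute[of v u]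
          matrix_vector_mult_scaleR algebra_simps power2_eq_square)
  qed
  moreover have "m *\<^sub>R v - A *v v \<in> S" using v(1) inv S by (simp add: subspace_diff subspace_scale)
  ultimately have "A *v v = m *\<^sub>R v" by (metis inner_eq_zero_iff right_minus_eq)
  with v(1) show thesis by (intro that) simp_all
qed

text \<open>Induction on the dimension: by symmetry the orthogonal complement of an eigenvector
  inside \<open>S\<close> is invariant again, so eigenvectors split off one at a time.\<close>

lemma symmetric_matrix_eigenbasis_subspace:
  fixes A :: "real^'n^'n"
  assumes sym: "transpose A = A"
  shows "subspace S \<Longrightarrow> (\<And>x. x \<in> S \<Longrightarrow> A *v x \<in> S) \<Longrightarrow>
    \<exists>B. B \<subseteq> S \<and> finite B \<and> card B = dim S \<and> pairwise orthogonal B \<and>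
        (\<forall>v\<in>B. norm v = 1 \<and> (\<exists>m. A *v v = m *\<^sub>R v))"
proof (induction "dim S" arbitrary: S)
  case 0
  then show ?case by (intro exI[of _ "{}"]) simp
next
  case (Suc n)
  then have "S \<noteq> {0}" by auto
  from symmetric_matrix_eigenvector[OF sym Suc.prems(1) Suc.prems(2) this]
  obtain v m where v: "v \<in> S" "norm v = 1" "A *v v = m *\<^sub>R v" by metis
  define T where "T = S \<inter> {x. v \<bullet> x = 0}"
  have T: "subspace T"
    unfolding T_def by (intro subspace_inter subspace_hyperplane Suc.prems(1))
  have inv: "A *v x \<in> T" if "x \<in> T" for x
    using that Suc.prems(2) symmetric_matrix_inner[OF sym, of v x] v(3)
    by (simp add: T_def inner_commute)
  have vv: "v \<bullet> v = 1" using v(2) by (simp add: norm_eq_1)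
  have "S = span (insert v T)"
  proof
    show "span (insert v T) \<subseteq> S"
      using v(1) Suc.prems(1) by (intro span_minimal) (auto simp: T_def)
    show "S \<subseteq> span (insert v T)"
    proof
      fix x assume "x \<in> S"
      then have "x - (v \<bullet> x) *\<^sub>R v \<in> T"
        using v(1) Suc.prems(1) by (simp add: T_def subspace_diff subspace_scale inner_diff_right vv)
      then show "x \<in> span (insert v T)"
        unfolding span_insert using span_base by blast
    qed
  qed
  moreover have "v \<notin> span T" using vv by (simp add: span_eq_iff[THEN iffD2, OF T]) (simp add: T_def)
  ultimately have "dim S = Suc (dim T)" by (simp add: dim_insert)
  with Suc.hyps have "n = dim T" by simp
  from Suc.hyps(1)[OF this T inv]
  obtain B where B: "B \<subseteq> T" "finite B" "card B = dim T" "pairwise orthogonal B"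
    "\<forall>v\<in>B. norm v = 1 \<and> (\<exists>m. A *v v = m *\<^sub>R v)" by blast
  have "v \<notin> B" using B(1) vv by (auto simp: T_def)
  with B(2,3) \<open>dim S = Suc (dim T)\<close> have "card (insert v B) = dim S" by simp
  moreover have "orthogonal v u" "u \<in> S" if "u \<in> B" for u
    using that B(1) by (auto simp: T_def orthogonal_def)
  then have "pairwise orthogonal (insert v B)" "insert v B \<subseteq> S"
    using B(4) v(1) by (auto simp: pairwise_insert orthogonal_commute)
  ultimately show ?case using B(2,5) v(2,3) by (intro exI[of _ "insert v B"]) blast
qed

text \<open>Indexing by the coordinate type gives the family full size, so completeness is a
  consequence rather than a clause. The eigenvalues \<open>l\<close> come with multiplicity and in
  no particular order.\<close>

definition orthonormal_eigenbasis :: "real^'n^'n \<Rightarrow> ('n \<Rightarrow> real^'n) \<Rightarrow> ('n \<Rightarrow> real) \<Rightarrow> bool" where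
  "orthonormal_eigenbasis A v l \<longleftrightarrow>
     (\<forall>i j. v i \<bullet> v j = (if i = j then 1 else 0)) \<and> (\<forall>i. A *v v i = l i *\<^sub>R v i)"

lemma symmetric_matrix_eigenbasis:
  fixes A :: "real^'n^'n"
  assumes "transpose A = A"
  obtains v l where "orthonormal_eigenbasis A v l"
proof -
  obtain B where B: "finite B" "card B = CARD('n)" "pairwise orthogonal B"
      "\<forall>v\<in>B. norm v = 1 \<and> (\<exists>m. A *v v = m *\<^sub>R v)"
    using symmetric_matrix_eigenbasis_subspace[OF assms, of UNIV] by auto
  then obtain v :: "'n \<Rightarrow> real^'n" where v: "bij_betw v UNIV B"
    using finite_same_card_bij[of "UNIV :: 'n set" B] by auto
  then have vB: "v i \<in> B" for i by (auto simp: bij_betw_def)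
  have "\<forall>i. \<exists>m. A *v v i = m *\<^sub>R v i" using B(4) vB by blast
  from choice[OF this] obtain l where "A *v v i = l i *\<^sub>R v i" for i by blast
  moreover have "v i \<bullet> v j = (if i = j then 1 else 0)" for i j
  proof (cases "i = j")
    case True
    moreover have "norm (v i) = 1" using B(4) vB by blast
    ultimately show ?thesis by (simp add: dot_square_norm)
  next
    case False
    then have "v i \<noteq> v j" using v by (metis UNIV_I bij_betw_imp_inj_on inj_onD)
    then show ?thesis using pairwiseD[OF B(3) vB vB] False by (simp add: orthogonal_def)
  qed
  ultimately have "orthonormal_eigenbasis A v l" by (simp add: orthonormal_eigenbasis_def)
  then show thesis by (rule that)
qed

lemma orthonormal_eigenbasis_expand:
  assumes "orthonormal_eigenbasis A v l"
  shows "(\<Sum>i\<in>UNIV. (v i \<bullet> x) *\<^sub>R v i) = x"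
proof -
  have on: "v i \<bullet> v j = (if i = j then 1 else 0)" for i j
    using assms by (simp add: orthonormal_eigenbasis_def)
  let ?P = "\<chi> i. v i"
  have "?P ** transpose ?P = mat 1"
    by (simp add: vec_eq_iff matrix_matrix_mult_def transpose_def mat_def on[unfolded inner_vec_def, simplified])
  \<comment> \<open>A right inverse of a square matrix is a left inverse; this turns orthonormality
    of the rows into the completeness relation.\<close>
  then have "transpose ?P ** ?P = mat 1" by (simp add: matrix_left_right_inverse)
  then have *: "(\<Sum>k\<in>UNIV. v k $ i * v k $ j) = (if i = j then 1 else 0)" for i j
    by (simp add: vec_eq_iff matrix_matrix_mult_def transpose_def mat_def)
  have "(\<Sum>i\<in>UNIV. (v i \<bullet> x) *\<^sub>R v i) $ p = x $ p" for p
  proof -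
    have "(\<Sum>i\<in>UNIV. (v i \<bullet> x) *\<^sub>R v i) $ p = (\<Sum>i\<in>UNIV. \<Sum>j\<in>UNIV. v i $ j * x $ j * v i $ p)"
      by (simp add: inner_vec_def sum_distrib_right)
    also have "\<dots> = (\<Sum>j\<in>UNIV. x $ j * (\<Sum>i\<in>UNIV. v i $ j * v i $ p))"
      by (subst sum.swap) (simp add: sum_distrib_left ac_simps)
    also have "\<dots> = x $ p" by (simp add: * if_distrib[of "(*) _"] cong: if_cong)
    finally show ?thesis .
  qed
  then show ?thesis by (simp add: vec_eq_iff)
qed

lemma orthonormal_eigenbasis_norm:
  assumes "orthonormal_eigenbasis A v l"
  shows "x \<bullet> x = (\<Sum>i\<in>UNIV. (v i \<bullet> x)\<^sup>2)"
proof -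
  have "x \<bullet> x = x \<bullet> (\<Sum>i\<in>UNIV. (v i \<bullet> x) *\<^sub>R v i)"
    by (simp add: orthonormal_eigenbasis_expand[OF assms])
  then show ?thesis by (simp add: inner_sum_right inner_commute power2_eq_square)
qed

lemma orthonormal_eigenbasis_form:
  assumes "orthonormal_eigenbasis A v l"
  shows "x \<bullet> (A *v x) = (\<Sum>i\<in>UNIV. l i * (v i \<bullet> x)\<^sup>2)"
proof -
  have "A *v x = A *v (\<Sum>i\<in>UNIV. (v i \<bullet> x) *\<^sub>R v i)"
    by (simp add: orthonormal_eigenbasis_expand[OF assms])
  also have "\<dots> = (\<Sum>i\<in>UNIV. (v i \<bullet> x) *\<^sub>R (l i *\<^sub>R v i))"
    using assms by (simp add: orthonormal_eigenbasis_def linear_sum matrix_vector_mult_scaleR)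
  finally show ?thesis by (simp add: inner_sum_right inner_commute power2_eq_square ac_simps)
qed

text \<open>Diagonalization over the polynomial ring, where the determinant in
  \<open>charpoly\<close> lives. The transpose of \<open>P\<close> has the eigenvectors as columns
  and intertwines the characteristic matrix with the diagonal \<open>D\<close>; its nonzero
  determinant cancels.\<close>

lemma charpoly_orthonormal_eigenbasis:
  fixes A :: "real^'n^'n"
  assumes "orthonormal_eigenbasis A v l"
  shows "charpoly A = (\<Prod>i\<in>UNIV. [:- l i, 1:])"
proof -
  have on: "v i \<bullet> v j = (if i = j then 1 else 0)" and ev: "A *v v i = l i *\<^sub>R v i" for i j
    using assms by (simp_all add: orthonormal_eigenbasis_def)
  define P :: "real poly^'n^'n" where "P = (\<chi> i j. [:v i $ j:])"
  define D :: "real poly^'n^'n" where "D = (\<chi> i j. if i = j then [:- l i, 1:] else 0)"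
  let ?M = "mat [:0, 1:] - map_matrix (\<lambda>a. [:a:]) A"
  have pc: "(\<Sum>i\<in>I. [:f i:]) = [:(\<Sum>i\<in>I. f i):]" for I :: "'n set" and f :: "'n \<Rightarrow> real"
    by (induction I rule: infinite_finite_induct) auto
  have PP: "P ** transpose P = mat 1"
  proof -
    have "(P ** transpose P) $ i $ j = mat 1 $ i $ j" for i j
    proof -
      have "(P ** transpose P) $ i $ j = [:v i \<bullet> v j:]"
        by (simp add: P_def matrix_matrix_mult_def transpose_def inner_vec_def pc mult.commute)
      then show ?thesis by (simp add: on mat_def)
    qed
    then show ?thesis by (simp add: vec_eq_iff)
  qed
  have MP: "?M ** transpose P = transpose P ** D"
  proof -
    have "(?M ** transpose P) $ i $ j = (transpose P ** D) $ i $ j" for i j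
    proof -
      have "(?M ** transpose P) $ i $ j =
          (\<Sum>k\<in>UNIV. (if i = k then [:0, 1:] else 0) * [:v j $ k:]) - (\<Sum>k\<in>UNIV. [:A $ i $ k * v j $ k:])"
        by (simp add: P_def matrix_matrix_mult_def transpose_def mat_def left_diff_distrib smult_diff_right
            sum_subtractf mult.commute)
      also have "(\<Sum>k\<in>UNIV. (if i = k then [:0, 1:] else 0) * [:v j $ k:]) = [:0, 1:] * [:v j $ i:]"
        by (subst sum.cong[OF refl, of _ _ "\<lambda>k. if k = i then [:0, 1:] * [:v j $ k:] else 0"]) auto
      also have "(\<Sum>k\<in>UNIV. [:A $ i $ k * v j $ k:]) = [:(A *v v j) $ i:]"
        by (simp add: matrix_vector_mult_def pc)
      also have "\<dots> = [:l j * v j $ i:]" by (simp add: ev)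
      also have "[:0, 1:] * [:v j $ i:] - [:l j * v j $ i:] = [:v j $ i:] * [:- l j, 1:]"
        by simp
      also have "\<dots> = (\<Sum>k\<in>UNIV. if k = j then [:v k $ i:] * [:- l j, 1:] else 0)"
        by simp
      also have "\<dots> = (transpose P ** D) $ i $ j"
        unfolding matrix_matrix_mult_def P_def D_def transpose_def
        by (simp only: vec_lambda_beta) (rule sum.cong, auto)
      finally show ?thesis .
    qed
    then show ?thesis by (simp add: vec_eq_iff)
  qed
  have dP: "det P * det (transpose P) = 1"
    using arg_cong[OF PP, of det] by (simp add: det_mul)
  have "det ?M * det (transpose P) = det D * det (transpose P)"
    using arg_cong[OF MP, of det] by (simp add: det_mul mult.commute)
  moreover have "det (transpose P) \<noteq> 0" using dP by auto
  ultimately have "det ?M = det D" by simp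
  also have "\<dots> = (\<Prod>i\<in>UNIV. D $ i $ i)" by (rule det_diagonal) (simp add: D_def)
  finally show ?thesis by (simp add: charpoly_def D_def)
qed

lemma eigenvalue_list_orthonormal_eigenbasis:
  fixes A :: "real^'n^'n"
  assumes "orthonormal_eigenbasis A v l"
  shows "eigenvalue_list A = sorted_list_of_multiset (image_mset l (mset_set UNIV))"
proof -
  have "proots (charpoly A) = (\<Sum>i\<in>UNIV. {#l i#})"
    by (simp add: charpoly_orthonormal_eigenbasis[OF assms] proots_prod)
  also have "\<dots> = image_mset l (mset_set UNIV)"
    unfolding sum_unfold_sum_mset by (induction "mset_set (UNIV :: 'n set)") auto
  finally show ?thesis by (simp add: eigenvalue_list_def)
qed

section \<open>Entries of a sorted list characterized by counting\<close>

section \<open>Order statistics\<close>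

text \<open>Counting strictly and weakly smaller values pins down the entry at position
  \<open>p\<close>, numbered from 0, without choosing a sorting permutation of the index
  type.\<close>

lemma sorted_list_of_multiset_nth_counts:
  fixes l :: "'n::finite \<Rightarrow> 'c::linorder"
  defines "xs \<equiv> sorted_list_of_multiset (image_mset l (mset_set UNIV))"
  assumes "p < CARD('n)"
  shows "xs ! p \<in> range l" "card {i. l i < xs ! p} \<le> p" "p < card {i. l i \<le> xs ! p}"
proof -
  have mset: "mset xs = image_mset l (mset_set UNIV)" by (simp add: xs_def)
  have len: "length xs = CARD('n)" using arg_cong[OF mset, of size] by simp
  have srt: "sorted xs" by (simp add: xs_def)
  \<comment> \<open>The same multiset is counted by indices of \<open>l\<close> and by list
    positions.\<close>
  have cnt: "card {i. P (l i)} = card {q. q < length xs \<and> P (xs ! q)}" for P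
  proof -
    have "size (filter_mset P (image_mset l (mset_set UNIV))) = card {i. P (l i)}"
      by (simp add: filter_mset_image_mset)
    moreover have "size (filter_mset P (mset xs)) = card {q. q < length xs \<and> P (xs ! q)}"
      by (simp add: length_filter_conv_card flip: mset_filter)
    ultimately show ?thesis by (simp add: mset)
  qed
  have "set xs = range l" using arg_cong[OF mset, of set_mset] by simp
  then show "xs ! p \<in> range l" using assms(2) len nth_mem by metis
  have "{q. q < length xs \<and> xs ! q < xs ! p} \<subseteq> {..<p}"
    using sorted_nth_mono[OF srt] by (auto simp: not_less[symmetric])
  from card_mono[OF _ this] show "card {i. l i < xs ! p} \<le> p"
    using cnt[of "\<lambda>z. z < xs ! p"] by simp
  have "{..p} \<subseteq> {q. q < length xs \<and> xs ! q \<le> xs ! p}"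
    using sorted_nth_mono[OF srt] assms(2) len by auto
  from card_mono[OF _ this] show "p < card {i. l i \<le> xs ! p}"
    using cnt[of "\<lambda>z. z \<le> xs ! p"] by simp
qed

section \<open>Disjointly supported test functions on a forest\<close>

section \<open>Acyclic graphs\<close>

definition restrict_vec :: "'n set \<Rightarrow> real^'n \<Rightarrow> real^'n" where
  "restrict_vec S f = (\<chi> i. if i \<in> S then f $ i else 0)"

lemma restrict_vec_nth [simp]: "restrict_vec S f $ i = (if i \<in> S then f $ i else 0)"
  by (simp add: restrict_vec_def)

lemma linear_restrict_vec: "linear (restrict_vec S)"
  by (rule linearI) (simp_all add: vec_eq_iff)

text \<open>For symmetric \<open>M\<close> and nonempty \<open>S\<close> this says that the least
  eigenvalue of the principal submatrix on \<open>S\<close> is at most \<open>c\<close>. The test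
  function lives on the whole index type, so no type of submatrices is needed.\<close>

definition dirichlet_le :: "real^'n^'n \<Rightarrow> real \<Rightarrow> 'n set \<Rightarrow> bool" where
  "dirichlet_le M c S \<longleftrightarrow> (\<exists>f. f \<noteq> 0 \<and> (\<forall>i. i \<notin> S \<longrightarrow> f $ i = 0) \<and> f \<bullet> (M *v f) \<le> c * (f \<bullet> f))"

lemma dirichlet_le_nonempty: "dirichlet_le M c S \<Longrightarrow> S \<noteq> {}"
  by (auto simp: dirichlet_le_def vec_eq_iff)

text \<open>The second conclusion is the strict form of the first; it later yields injectivity of a
  restriction map.\<close>

lemma not_dirichlet_leD:
  assumes "\<not> dirichlet_le M c S" "\<And>i. i \<notin> S \<Longrightarrow> f $ i = 0"
  shows "c * (f \<bullet> f) \<le> f \<bullet> (M *v f)" "f \<bullet> (M *v f) \<le> c * (f \<bullet> f) \<Longrightarrow> f = 0"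
  using assms unfolding dirichlet_le_def by (cases "f = 0"; force)+

text \<open>No entry of \<open>M\<close> couples \<open>S\<close> with \<open>T\<close>, so the
  cross term vanishes.\<close>

lemma matrix_form_restrict_split:
  fixes M :: "real^'n^'n"
  assumes sym: "transpose M = M" and disj: "S \<inter> T = {}"
    and sep: "\<And>i j. i \<in> S \<Longrightarrow> j \<in> T \<Longrightarrow> M $ i $ j = 0"
    and f: "\<And>i. i \<notin> S \<union> T \<Longrightarrow> f $ i = 0"
  shows "f \<bullet> (M *v f) = restrict_vec S f \<bullet> (M *v restrict_vec S f) + restrict_vec T f \<bullet> (M *v restrict_vec T f)"
    and "f \<bullet> f = restrict_vec S f \<bullet> restrict_vec S f + restrict_vec T f \<bullet> restrict_vec T f"
proof -
  have eq: "f = restrict_vec S f + restrict_vec T f"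
    using disj f by (auto simp: vec_eq_iff)
  have "restrict_vec S f \<bullet> (M *v restrict_vec T f) = 0"
    using sep by (auto simp: inner_vec_def matrix_vector_mult_def intro!: sum.neutral)
  then show "f \<bullet> (M *v f) = restrict_vec S f \<bullet> (M *v restrict_vec S f) + restrict_vec T f \<bullet> (M *v restrict_vec T f)"
    using matrix_form_add[OF sym, of "restrict_vec S f" "restrict_vec T f"] eq by simp
  have "restrict_vec S f \<bullet> restrict_vec T f = 0"
    using disj by (auto simp: inner_vec_def intro!: sum.neutral)
  then have "(restrict_vec S f + restrict_vec T f) \<bullet> (restrict_vec S f + restrict_vec T f) =
      restrict_vec S f \<bullet> restrict_vec S f + restrict_vec T f \<bullet> restrict_vec T f"
    by (simp add: inner_add_left inner_add_right inner_commute)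
  then show "f \<bullet> f = restrict_vec S f \<bullet> restrict_vec S f + restrict_vec T f \<bullet> restrict_vec T f"
    using eq by simp
qed

text \<open>The connected component in the subgraph induced on \<open>S\<close>. For
  \<open>x\<close> outside \<open>S\<close> reflexivity leaves just \<open>{x}\<close>, whence the
  hypothesis of \<open>component_subset\<close>.\<close>

definition component :: "('a \<Rightarrow> 'a \<Rightarrow> bool) \<Rightarrow> 'a set \<Rightarrow> 'a \<Rightarrow> 'a set" where
  "component E S x = {y. (\<lambda>a b. a \<in> S \<and> b \<in> S \<and> E a b)\<^sup>*\<^sup>* x y}"

lemma component_self: "x \<in> component E S x"
  by (simp add: component_def)

lemma component_subset: "x \<in> S \<Longrightarrow> component E S x \<subseteq> S"
  unfolding component_def by (auto elim: rtranclp.cases)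

lemma component_closed:
  "y \<in> component E S x \<Longrightarrow> y \<in> S \<Longrightarrow> z \<in> S \<Longrightarrow> E y z \<Longrightarrow> z \<in> component E S x"
  unfolding component_def by (auto intro: rtranclp.rtrancl_into_rtrancl)

lemma component_connected:
  assumes "symp E" "a \<in> component E S x" "b \<in> component E S x"
  shows "(\<lambda>a b. a \<in> S \<and> b \<in> S \<and> E a b)\<^sup>*\<^sup>* a b"
proof -
  have "symp (\<lambda>a b. a \<in> S \<and> b \<in> S \<and> E a b)" using assms(1) by (auto simp: symp_def)
  then have "symp (\<lambda>a b. a \<in> S \<and> b \<in> S \<and> E a b)\<^sup>*\<^sup>*" by (rule symp_rtranclp)
  then show ?thesis using assms(2,3) unfolding component_def by (auto dest: sympD intro: rtranclp_trans)
qed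

text \<open>Loop erasure: if the new first vertex already lies on the path, the path is cut back to
  that occurrence.\<close>

lemma rtranclp_imp_distinct_path:
  assumes "(\<lambda>x y. x \<in> S \<and> y \<in> S \<and> E x y)\<^sup>*\<^sup>* a b" "b \<in> S"
  shows "\<exists>p. p \<noteq> [] \<and> hd p = a \<and> last p = b \<and> set p \<subseteq> S \<and> successively E p \<and> distinct p"
  using assms(1)
proof (induction rule: converse_rtranclp_induct)
  case base
  then show ?case using assms(2) by (intro exI[of _ "[b]"]) simp
next
  case (step a y)
  then obtain p where p: "p \<noteq> []" "hd p = y" "last p = b" "set p \<subseteq> S" "successively E p" "distinct p"
    by blast
  show ?case
  proof (cases "a \<in> set p")
    case True
    then obtain us vs where "p = us @ a # vs" by (auto simp: in_set_conv_decomp)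
    then show ?thesis using p by (intro exI[of _ "a # vs"]) (auto simp: successively_append_iff)
  next
    case False
    then show ?thesis using p step.hyps(1)
      by (intro exI[of _ "a # p"]) (auto simp: successively_Cons)
  qed
qed

text \<open>Two distinct neighbours of \<open>v\<close> would be joined by a simple path inside
  \<open>S\<close>, and \<open>v\<close>, lying outside \<open>S\<close>, would close it to a cycle
  of length at least 3.\<close>

lemma acyclic_unique_neighbour:
  fixes G :: "'a::finite wgraph"
  assumes sym: "symp (adj G)" and acyc: "\<nexists>c. graph_cycle G c" and S: "x \<in> S" "v \<notin> S"
    and ab: "a \<in> component (adj G) S x" "b \<in> component (adj G) S x" "adj G v a" "adj G v b"
  shows "a = b"
proof (rule ccontr)
  assume "a \<noteq> b"
  have bS: "b \<in> S" using component_subset[OF S(1)] ab(2) by blast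
  obtain p where p: "p \<noteq> []" "hd p = a" "last p = b" "set p \<subseteq> S" "successively (adj G) p" "distinct p"
    using rtranclp_imp_distinct_path[OF component_connected[OF sym ab(1,2)] bS] by blast
  have "length p \<ge> 2"
    using p(1-3) \<open>a \<noteq> b\<close> by (cases p; cases "tl p") auto
  then have "graph_cycle G (v # p)"
    using p S(2) ab(3,4) sympD[OF sym]
    by (auto simp: graph_cycle_def successively_Cons)
  with acyc show False by blast
qed

text \<open>Take a test function of smallest support and the component of a point of that support.
  The part off this component has smaller support, so it violates the bound or is zero; as the form
  splits, the part on the component obeys the bound.\<close>

lemma dirichlet_le_component:
  fixes M :: "real^'n^'n"
  assumes sym: "transpose M = M" and E: "\<And>i j. i \<noteq> j \<Longrightarrow> \<not> E i j \<Longrightarrow> M $ i $ j = 0"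
    and "dirichlet_le M c S"
  obtains x where "x \<in> S" "dirichlet_le M c (component E S x)"
proof -
  let ?P = "\<lambda>f :: real^'n. f \<noteq> 0 \<and> (\<forall>i. i \<notin> S \<longrightarrow> f $ i = 0) \<and> f \<bullet> (M *v f) \<le> c * (f \<bullet> f)"
  obtain f where f: "?P f" and min: "\<And>g. ?P g \<Longrightarrow> card {i. f $ i \<noteq> 0} \<le> card {i. g $ i \<noteq> 0}"
    using assms(3) ex_has_least_nat[of ?P _ "\<lambda>f :: real^'n. card {i. f $ i \<noteq> 0}"]
    unfolding dirichlet_le_def by blast
  obtain x where x: "f $ x \<noteq> 0" using f by (auto simp: vec_eq_iff)
  then have xS: "x \<in> S" using f by blast
  define C where "C = component E S x"
  have CS: "C \<subseteq> S" unfolding C_def by (rule component_subset[OF xS])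
  have xC: "x \<in> C" unfolding C_def by (rule component_self)
  have sep: "M $ i $ j = 0" if "i \<in> C" "j \<in> S - C" for i j
    using that CS component_closed[of i E S x j] E[of i j] unfolding C_def by blast
  let ?g = "restrict_vec C f" and ?h = "restrict_vec (S - C) f"
  have disj: "C \<inter> (S - C) = {}" by blast
  have f0: "f $ i = 0" if "i \<notin> C \<union> (S - C)" for i using f that by blast
  have split: "f \<bullet> (M *v f) = ?g \<bullet> (M *v ?g) + ?h \<bullet> (M *v ?h)" "f \<bullet> f = ?g \<bullet> ?g + ?h \<bullet> ?h"
    by (rule matrix_form_restrict_split[OF sym disj sep f0], assumption+)+
  have "{i. ?h $ i \<noteq> 0} \<subset> {i. f $ i \<noteq> 0}"
    using x xC by auto
  then have "card {i. ?h $ i \<noteq> 0} < card {i. f $ i \<noteq> 0}"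
    by (intro psubset_card_mono) auto
  then have "\<not> ?P ?h" using min[of ?h] by (meson not_le)
  then have "c * (?h \<bullet> ?h) \<le> ?h \<bullet> (M *v ?h)" by (cases "?h = 0") auto
  then have "?g \<bullet> (M *v ?g) \<le> c * (?g \<bullet> ?g)"
    using split f by (simp add: distrib_left)
  moreover have "?g \<noteq> 0" using x xC by (auto simp: vec_eq_iff)
  ultimately have "dirichlet_le M c C" unfolding dirichlet_le_def by (intro exI[of _ ?g]) simp
  then show thesis using that xS by (simp add: C_def)
qed

text \<open>
  The set \<open>T\<close> is a smallest branch of \<open>U\<close> carrying a test function, where a branch hangs on the
  rest of \<open>U\<close> through the single vertex \<open>v\<close>. By acyclicity every component of \<open>T - {v}\<close> is again a
  branch.
\<close>

lemma dirichlet_le_minimal_branch: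
  fixes M :: "real^'n^'n" and G :: "'n wgraph"
  assumes sym: "transpose M = M" and E: "\<And>i j. i \<noteq> j \<Longrightarrow> \<not> adj G i j \<Longrightarrow> M $ i $ j = 0"
    and symG: "symp (adj G)" and acyc: "\<nexists>c. graph_cycle G c"
    and good: "dirichlet_le M c U"
  obtains T v where "T \<subseteq> U" "v \<in> T" "dirichlet_le M c T" "\<not> dirichlet_le M c (T - {v})"
    "\<And>i j. i \<in> T - {v} \<Longrightarrow> j \<in> U - T \<Longrightarrow> \<not> adj G i j"
proof -
  let ?P = "\<lambda>T. T \<subseteq> U \<and> dirichlet_le M c T \<and> (\<exists>v\<in>T. \<forall>i\<in>T - {v}. \<forall>j\<in>U - T. \<not> adj G i j)"
  \<comment> \<open>\<open>U\<close> is a branch of itself: nothing of \<open>U\<close> lies outside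
    it, so any vertex can serve as \<open>v\<close>.\<close>
  have "?P U" using good dirichlet_le_nonempty[OF good] by auto
  then obtain T where T: "?P T" and min: "\<And>T'. ?P T' \<Longrightarrow> card T \<le> card T'"
    using ex_has_least_nat[of ?P U card] by blast
  then obtain v where v: "v \<in> T" "\<And>i j. i \<in> T - {v} \<Longrightarrow> j \<in> U - T \<Longrightarrow> \<not> adj G i j" by blast
  have "\<not> dirichlet_le M c (T - {v})"
  proof
    assume "dirichlet_le M c (T - {v})"
    from dirichlet_le_component[OF sym E this]
    obtain x where x: "x \<in> T - {v}" "dirichlet_le M c (component (adj G) (T - {v}) x)" by blast
    define C where "C = component (adj G) (T - {v}) x"
    have CT: "C \<subseteq> T - {v}" unfolding C_def by (rule component_subset[OF x(1)])
    \<comment> \<open>If \<open>v\<close> has no neighbour in \<open>C\<close>, any vertex of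
      \<open>C\<close> can serve as the attaching vertex.\<close>
    have "\<exists>w\<in>C. \<forall>z\<in>C. adj G v z \<longrightarrow> z = w"
      using acyclic_unique_neighbour[OF symG acyc x(1), of v] component_self[of x]
      unfolding C_def by blast
    then obtain w where w: "w \<in> C" "\<And>z. z \<in> C \<Longrightarrow> adj G v z \<Longrightarrow> z = w" by blast
    \<comment> \<open>An edge from \<open>C\<close> to the rest of \<open>U\<close> cannot leave
      \<open>T\<close>, because \<open>T\<close> is attached at \<open>v\<close>, and cannot end in
      \<open>T - {v}\<close>, because \<open>C\<close> is a component there. It ends at
      \<open>v\<close>, so it starts at \<open>w\<close>.\<close>
    have "\<not> adj G i j" if "i \<in> C - {w}" "j \<in> U - C" for i j
    proof
      assume a: "adj G i j"
      have "j \<noteq> v" using w(2)[of i] that sympD[OF symG a] by blast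
      moreover have "j \<in> T" using v(2)[of i j] a that CT by blast
      ultimately have "j \<in> C"
        using component_closed[of i "adj G" "T - {v}" x j] a that CT unfolding C_def by blast
      then show False using that by blast
    qed
    then have "?P C" using x(2) CT T w(1) unfolding C_def[symmetric] by blast
    moreover have "card C < card T" using CT v(1) by (intro psubset_card_mono) auto
    ultimately show False using min[of C] by linarith
  qed
  then show thesis using that T v by blast
qed

text \<open>Dimension formula for the sum of \<open>W\<close> and the hyperplane, whose dimension is
  at most that of the whole space.\<close>

lemma dim_hyperplane_Int:
  fixes W :: "'a::euclidean_space set"
  assumes "subspace W" "a \<noteq> 0"
  shows "dim W \<le> Suc (dim (W \<inter> {x. a \<bullet> x = 0}))"
proof -
  let ?H = "{x. a \<bullet> x = 0}"
  have "dim {x + y |x y. x \<in> W \<and> y \<in> ?H} + dim (W \<inter> ?H) = dim W + dim ?H"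
    by (rule dim_sums_Int[OF assms(1) subspace_hyperplane])
  moreover have "dim {x + y |x y. x \<in> W \<and> y \<in> ?H} \<le> DIM('a)" by (rule dim_subset_UNIV)
  moreover have "dim ?H = DIM('a) - 1" by (rule dim_hyperplane[OF assms(2)])
  moreover have "DIM('a) > 0" by simp
  ultimately show ?thesis by linarith
qed

text \<open>
  Deleting \<open>v\<close> costs at most one dimension, and on \<open>T - {v}\<close> the form exceeds \<open>c\<close>, so
  restriction to \<open>U - T\<close> stays injective and keeps the form below \<open>c\<close>.
\<close>

lemma acyclic_disjoint_dirichlet_le:
  fixes M :: "real^'n^'n" and G :: "'n wgraph"
  assumes sym: "transpose M = M" and E: "\<And>i j. i \<noteq> j \<Longrightarrow> \<not> adj G i j \<Longrightarrow> M $ i $ j = 0"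
    and symG: "symp (adj G)" and acyc: "\<nexists>c. graph_cycle G c"
  shows "subspace W \<Longrightarrow> m \<le> dim W \<Longrightarrow> (\<And>f i. f \<in> W \<Longrightarrow> i \<notin> U \<Longrightarrow> f $ i = 0) \<Longrightarrow>
    (\<And>f. f \<in> W \<Longrightarrow> f \<bullet> (M *v f) \<le> c * (f \<bullet> f)) \<Longrightarrow>
    \<exists>A :: nat \<Rightarrow> 'n set. (\<forall>i<m. A i \<subseteq> U \<and> dirichlet_le M c (A i)) \<and> disjoint_family_on A {..<m}"
\<comment> \<open>Both \<open>W\<close> and \<open>U\<close> vary: the recursion continues on
  \<open>U - T\<close> with the restrictions of the functions in \<open>W\<close> that vanish at
  \<open>v\<close>.\<close>
proof (induction m arbitrary: W U)
  case 0
  then show ?case by (simp add: disjoint_family_on_def)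
next
  case (Suc m)
  have "W \<noteq> {0}" using Suc.prems(2) by auto
  then obtain f where "f \<in> W" "f \<noteq> 0" using subspace_0[OF Suc.prems(1)] by blast
  then have "dirichlet_le M c U" unfolding dirichlet_le_def using Suc.prems(3,4) by blast
  from dirichlet_le_minimal_branch[OF sym E symG acyc this]
  obtain T v where T: "T \<subseteq> U" "v \<in> T" "dirichlet_le M c T" "\<not> dirichlet_le M c (T - {v})"
    and sep: "\<And>i j. i \<in> T - {v} \<Longrightarrow> j \<in> U - T \<Longrightarrow> \<not> adj G i j" by metis
  define W' where "W' = W \<inter> {f. axis v 1 \<bullet> f = 0}"
  let ?r = "restrict_vec (U - T)" and ?s = "restrict_vec (T - {v})"
  have W': "subspace W'"
    unfolding W'_def by (intro subspace_inter subspace_hyperplane Suc.prems(1))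
  have "m \<le> dim W'"
    using dim_hyperplane_Int[OF Suc.prems(1), of "axis v 1"] Suc.prems(2)
    by (simp add: W'_def axis_eq_0_iff)
  \<comment> \<open>Once \<open>f\<close> vanishes at \<open>v\<close>, it lives on
    \<open>T - {v}\<close> and \<open>U - T\<close>, between which there are no edges.\<close>
  have split: "f \<bullet> (M *v f) = ?s f \<bullet> (M *v ?s f) + ?r f \<bullet> (M *v ?r f)" "f \<bullet> f = ?s f \<bullet> ?s f + ?r f \<bullet> ?r f"
    and fv: "\<And>i. i \<notin> (T - {v}) \<union> (U - T) \<Longrightarrow> f $ i = 0"
    if "f \<in> W'" for f
  proof -
    have "f $ v = 0" using that by (simp add: W'_def inner_axis' inner_axis)
    then show fv: "f $ i = 0" if "i \<notin> (T - {v}) \<union> (U - T)" for i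
      using that Suc.prems(3)[of f i] \<open>f \<in> W'\<close> by (cases "i = v") (auto simp: W'_def)
    have sep0: "M $ i $ j = 0" if "i \<in> T - {v}" "j \<in> U - T" for i j
      using that sep E[of i j] by blast
    have disj: "(T - {v}) \<inter> (U - T) = {}" by blast
    show "f \<bullet> (M *v f) = ?s f \<bullet> (M *v ?s f) + ?r f \<bullet> (M *v ?r f)" "f \<bullet> f = ?s f \<bullet> ?s f + ?r f \<bullet> ?r f"
      by (rule matrix_form_restrict_split[OF sym disj sep0 fv], assumption+)+
  qed
  have s_ge: "c * (?s f \<bullet> ?s f) \<le> ?s f \<bullet> (M *v ?s f)" for f
    by (rule not_dirichlet_leD(1)[OF T(4)]) auto
  have r_le: "?r f \<bullet> (M *v ?r f) \<le> c * (?r f \<bullet> ?r f)" if "f \<in> W'" for f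
    using split[OF that] s_ge[of f] Suc.prems(4)[of f] that by (simp add: W'_def distrib_left)
  \<comment> \<open>A function killed by the restriction lives on \<open>T - {v}\<close>, where only
    zero satisfies the bound \<open>c\<close>.\<close>
  have "f = 0" if "f \<in> W'" "?r f = 0" for f
  proof -
    have "f $ i = ?s f $ i" for i
      using fv[OF that(1), of i] that(2) by (auto simp: vec_eq_iff split: if_splits)
    then have "?s f = f" by (simp add: vec_eq_iff)
    then show ?thesis
      using not_dirichlet_leD(2)[OF T(4), of f] Suc.prems(4)[of f] that(1)
      by (metis IntD1 W'_def restrict_vec_nth)
  qed
  then have "inj_on ?r W'"
    using linear_inj_on_iff_eq_0[OF linear_restrict_vec W'] by blast
  then have "dim (?r ` W') = dim W'"
    using dim_image_eq[OF linear_restrict_vec, of "U - T" W'] W' by (simp add: span_eq_iff[THEN iffD2])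
  with \<open>m \<le> dim W'\<close> have "m \<le> dim (?r ` W')" by simp
  moreover have "subspace (?r ` W')" by (rule linear_subspace_image[OF linear_restrict_vec W'])
  ultimately have "\<exists>A :: nat \<Rightarrow> 'n set. (\<forall>i<m. A i \<subseteq> U - T \<and> dirichlet_le M c (A i)) \<and>
      disjoint_family_on A {..<m}"
    using r_le by (intro Suc.IH[of "?r ` W'" "U - T"]) auto
  then obtain A where A: "\<forall>i<m. A i \<subseteq> U - T \<and> dirichlet_le M c (A i)" "disjoint_family_on A {..<m}"
    by blast
  have "A i \<inter> T = {}" if "i < m" for i using A(1) that by blast
  then have "disjoint_family_on (A(m := T)) {..<Suc m}"
    using A(2) unfolding disjoint_family_on_def lessThan_Suc by (simp add: Int_commute)
  moreover have "\<forall>i<Suc m. (A(m := T)) i \<subseteq> U \<and> dirichlet_le M c ((A(m := T)) i)"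
    using A(1) T(1,3) by (auto simp: less_Suc_eq)
  ultimately show ?case by blast
qed

section \<open>Co-area inequality, quadratic form of the Laplacian, and a Cheeger bound inside a
  given vertex set\<close>

section \<open>Cheeger inequality with Dirichlet conditions\<close>

text \<open>Discrete co-area argument by induction on the support \<open>S\<close> of
  \<open>g\<close>: the lowest layer, a constant \<open>t\<close> on \<open>S\<close>, is peeled off
  and contributes \<open>t\<close> times the cut of \<open>S\<close>. The factor 2 arises because
  the double sum visits each pair in both orders.\<close>

lemma coarea_lower_bound:
  fixes a :: "'n::finite \<Rightarrow> 'n \<Rightarrow> real" and g :: "'n \<Rightarrow> real"
  assumes sym: "\<And>i j. a i j = a j i"
    and cut: "\<And>S. S \<subseteq> U \<Longrightarrow> S \<noteq> {} \<Longrightarrow> h * real (card S) \<le> (\<Sum>i\<in>S. \<Sum>j\<in>- S. a i j)"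
  shows "(\<And>i. 0 \<le> g i) \<Longrightarrow> (\<And>i. i \<notin> U \<Longrightarrow> g i = 0) \<Longrightarrow>
    2 * h * (\<Sum>i\<in>UNIV. g i) \<le> (\<Sum>i\<in>UNIV. \<Sum>j\<in>UNIV. a i j * \<bar>g i - g j\<bar>)"
proof (induction "card {i. g i > 0}" arbitrary: g rule: less_induct)
  case less
  define S where "S = {i. g i > 0}"
  show ?case
  proof (cases "S = {}")
    case True
    then have "g i = 0" for i using less.prems(1)[of i] by (auto simp: S_def not_less intro: antisym)
    then show ?thesis by simp
  next
    case False
    \<comment> \<open>Subtracting the smallest positive value keeps \<open>g\<close> nonnegative and
      removes its minimizer from the support.\<close>
    define t where "t = Min (g ` S)"
    have t_le: "t \<le> g i" if "i \<in> S" for i using that by (simp add: t_def)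
    have "t \<in> g ` S" unfolding t_def using False by (intro Min_in) auto
    then obtain m where m: "m \<in> S" "g m = t" by blast
    then have "t > 0" by (auto simp: S_def)
    have g0: "g i = 0" if "i \<notin> S" for i
      using that less.prems(1)[of i] by (auto simp: S_def)
    define g' where "g' i = g i - (if i \<in> S then t else 0)" for i
    have g'0: "0 \<le> g' i" for i using t_le[of i] less.prems(1)[of i] by (simp add: g'_def)
    have "{i. g' i > 0} \<subset> S"
    proof
      show "{i. g' i > 0} \<subseteq> S" using g0 by (auto simp: g'_def split: if_splits)
      show "{i. g' i > 0} \<noteq> S" using m by (auto simp: g'_def)
    qed
    then have "card {i. g' i > 0} < card {i. g i > 0}" unfolding S_def[symmetric]
      by (intro psubset_card_mono) auto
    moreover have "g' i = 0" if "i \<notin> U" for i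
      using less.prems(2)[OF that] by (simp add: g'_def S_def)
    ultimately have IH: "2 * h * (\<Sum>i\<in>UNIV. g' i) \<le> (\<Sum>i\<in>UNIV. \<Sum>j\<in>UNIV. a i j * \<bar>g' i - g' j\<bar>)"
      using less.hyps[of g'] g'0 by blast
    define I where "I i j = (if i \<in> S \<and> j \<notin> S then a i j else 0)" for i j
    have cutI: "(\<Sum>i\<in>UNIV. \<Sum>j\<in>UNIV. I i j) = (\<Sum>i\<in>S. \<Sum>j\<in>- S. a i j)"
    proof -
      have "(\<Sum>i\<in>UNIV. \<Sum>j\<in>UNIV. I i j) = (\<Sum>i\<in>UNIV. if i \<in> S then \<Sum>j\<in>UNIV. if j \<in> - S then a i j else 0 else 0)"
        by (intro sum.cong refl) (auto simp: I_def)
      then show ?thesis by (simp add: sum.If_cases Compl_eq)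
    qed
    \<comment> \<open>Only pairs with exactly one end in \<open>S\<close> feel the subtraction; for
      them the difference drops by exactly \<open>t\<close>.\<close>
    have "a i j * \<bar>g i - g j\<bar> = a i j * \<bar>g' i - g' j\<bar> + t * (I i j + I j i)" for i j
      using t_le[of i] t_le[of j] g0[of i] g0[of j] sym[of i j] \<open>t > 0\<close>
      by (auto simp: g'_def I_def algebra_simps)
    then have "(\<Sum>i\<in>UNIV. \<Sum>j\<in>UNIV. a i j * \<bar>g i - g j\<bar>) =
        (\<Sum>i\<in>UNIV. \<Sum>j\<in>UNIV. a i j * \<bar>g' i - g' j\<bar>)
        + t * ((\<Sum>i\<in>UNIV. \<Sum>j\<in>UNIV. I i j) + (\<Sum>i\<in>UNIV. \<Sum>j\<in>UNIV. I j i))"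
      by (simp add: sum.distrib sum_distrib_left distrib_left)
    also have "(\<Sum>i\<in>UNIV. \<Sum>j\<in>UNIV. I j i) = (\<Sum>i\<in>UNIV. \<Sum>j\<in>UNIV. I i j)"
      by (rule sum.swap)
    finally have 1: "(\<Sum>i\<in>UNIV. \<Sum>j\<in>UNIV. a i j * \<bar>g i - g j\<bar>) =
        (\<Sum>i\<in>UNIV. \<Sum>j\<in>UNIV. a i j * \<bar>g' i - g' j\<bar>) + 2 * t * (\<Sum>i\<in>S. \<Sum>j\<in>- S. a i j)"
      by (simp add: cutI)
    have "(\<Sum>i\<in>UNIV. g i) = (\<Sum>i\<in>UNIV. g' i + (if i \<in> S then t else 0))"
      by (simp add: g'_def)
    also have "\<dots> = (\<Sum>i\<in>UNIV. g' i) + t * real (card S)"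
      by (simp add: sum.distrib sum.If_cases mult.commute)
    finally have 2: "(\<Sum>i\<in>UNIV. g i) = (\<Sum>i\<in>UNIV. g' i) + t * real (card S)" .
    have "S \<subseteq> U" using less.prems(2) by (force simp: S_def)
    from mult_left_mono[OF cut[OF this False], of "2 * t"] \<open>t > 0\<close>
    have "2 * h * (t * real (card S)) \<le> 2 * t * (\<Sum>i\<in>S. \<Sum>j\<in>- S. a i j)"
      by (simp add: ac_simps)
    with IH show ?thesis unfolding 1 2 by (simp add: distrib_left)
  qed
qed

text \<open>Extending the weights by zero off the edges turns sums over neighbours into sums over
  the whole type.\<close>

definition edge_weight :: "'a::finite wgraph \<Rightarrow> 'a \<Rightarrow> 'a \<Rightarrow> real" where
  "edge_weight G i j = (if adj G i j then wt G i j else 0)"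

lemma edge_weight_nonneg: "weighted_graph G \<Longrightarrow> 0 \<le> edge_weight G i j"
  by (auto simp: edge_weight_def weighted_graph_def intro: less_imp_le)

lemma edge_weight_commute: "weighted_graph G \<Longrightarrow> edge_weight G i j = edge_weight G j i"
  by (auto simp: edge_weight_def weighted_graph_def dest: sympD)

lemma edge_weight_self: "weighted_graph G \<Longrightarrow> edge_weight G i i = 0"
  by (auto simp: edge_weight_def weighted_graph_def dest: irreflpD)

lemma wdegree_edge_weight: "wdegree G i = (\<Sum>j\<in>UNIV. edge_weight G i j)"
  by (simp add: wdegree_def edge_weight_def sum.If_cases)

lemma wdegree_nonneg: "weighted_graph G \<Longrightarrow> 0 \<le> wdegree G i"
  by (simp add: wdegree_edge_weight sum_nonneg edge_weight_nonneg)

lemma wdegree_le_max: "wdegree G i \<le> max_wdegree G"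
  by (simp add: max_wdegree_def)

lemma max_wdegree_attained: obtains i where "max_wdegree G = wdegree G i"
proof -
  have "max_wdegree G \<in> range (wdegree G)" unfolding max_wdegree_def by (rule Max_in) auto
  then show thesis using that by blast
qed

lemma expansion_edge_weight:
  "expansion G S = (\<Sum>i\<in>S. \<Sum>j\<in>- S. edge_weight G i j) / real (card S)"
proof -
  have "(\<Sum>j | j \<notin> S \<and> adj G i j. wt G i j) = (\<Sum>j\<in>- S. edge_weight G i j)" for i
    unfolding edge_weight_def by (simp add: sum.If_cases) (rule sum.cong, auto)
  then show ?thesis by (simp add: expansion_def)
qed

lemma laplacian_nth:
  "laplacian G $ i $ j = (if i = j then wdegree G i + pot G i else 0) - edge_weight G i j"
  by (simp add: laplacian_def diag_matrix_def adj_matrix_def edge_weight_def)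

lemma laplacian_symmetric: "weighted_graph G \<Longrightarrow> transpose (laplacian G) = laplacian G"
  by (simp add: vec_eq_iff transpose_def laplacian_nth edge_weight_commute)

text \<open>Expanding the square gives the degree term twice, by symmetry of the weights. Both sides
  are doubled because the sum over ordered pairs meets every edge twice.\<close>

lemma laplacian_form:
  assumes "weighted_graph G"
  shows "2 * (f \<bullet> (laplacian G *v f)) =
    2 * (\<Sum>i\<in>UNIV. pot G i * (f $ i)\<^sup>2) + (\<Sum>i\<in>UNIV. \<Sum>j\<in>UNIV. edge_weight G i j * (f $ i - f $ j)\<^sup>2)"
proof -
  let ?a = "edge_weight G"
  have "(laplacian G *v f) $ i = (wdegree G i + pot G i) * f $ i - (\<Sum>j\<in>UNIV. ?a i j * f $ j)" for i
    by (simp add: matrix_vector_mult_def laplacian_nth left_diff_distrib sum_subtractf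
        if_distribR if_distrib[of "\<lambda>x. x * _"] cong: if_cong)
  then have L: "f \<bullet> (laplacian G *v f) =
      (\<Sum>i\<in>UNIV. pot G i * (f $ i)\<^sup>2) + (\<Sum>i\<in>UNIV. wdegree G i * (f $ i)\<^sup>2)
      - (\<Sum>i\<in>UNIV. \<Sum>j\<in>UNIV. ?a i j * (f $ i * f $ j))"
    by (simp add: inner_vec_def right_diff_distrib distrib_left distrib_right power2_eq_square
        sum.distrib sum_subtractf sum_distrib_left ac_simps)
  have d: "(\<Sum>i\<in>UNIV. wdegree G i * (f $ i)\<^sup>2) = (\<Sum>i\<in>UNIV. \<Sum>j\<in>UNIV. ?a i j * (f $ i)\<^sup>2)"
    by (simp add: wdegree_edge_weight sum_distrib_right)
  also have "\<dots> = (\<Sum>i\<in>UNIV. \<Sum>j\<in>UNIV. ?a i j * (f $ j)\<^sup>2)"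
    by (subst sum.swap) (simp add: edge_weight_commute[OF assms])
  finally have d': "(\<Sum>i\<in>UNIV. wdegree G i * (f $ i)\<^sup>2) = (\<Sum>i\<in>UNIV. \<Sum>j\<in>UNIV. ?a i j * (f $ j)\<^sup>2)" .
  have "(\<Sum>i\<in>UNIV. \<Sum>j\<in>UNIV. ?a i j * (f $ i - f $ j)\<^sup>2) =
      (\<Sum>i\<in>UNIV. \<Sum>j\<in>UNIV. ?a i j * (f $ i)\<^sup>2) + (\<Sum>i\<in>UNIV. \<Sum>j\<in>UNIV. ?a i j * (f $ j)\<^sup>2)
      - 2 * (\<Sum>i\<in>UNIV. \<Sum>j\<in>UNIV. ?a i j * (f $ i * f $ j))"
    by (simp add: power2_diff algebra_simps sum.distrib sum_subtractf sum_distrib_left)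
  then show ?thesis using L d d' by linarith
qed

lemma laplacian_form_ge_dirichlet_energy:
  assumes "weighted_graph G" "\<forall>x. pot G x \<ge> 0"
  shows "(\<Sum>i\<in>UNIV. \<Sum>j\<in>UNIV. edge_weight G i j * (f $ i - f $ j)\<^sup>2) \<le> 2 * (f \<bullet> (laplacian G *v f))"
  using assms by (simp add: laplacian_form sum_nonneg)

lemma laplacian_form_nonneg:
  assumes "weighted_graph G" "\<forall>x. pot G x \<ge> 0"
  shows "0 \<le> f \<bullet> (laplacian G *v f)"
proof -
  have "0 \<le> (\<Sum>i\<in>UNIV. \<Sum>j\<in>UNIV. edge_weight G i j * (f $ i - f $ j)\<^sup>2)"
    by (intro sum_nonneg mult_nonneg_nonneg edge_weight_nonneg assms(1)) auto
  with laplacian_form_ge_dirichlet_energy[OF assms, of f] show ?thesis by linarith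
qed

text \<open>The ordinary inequality over pairs, with the square root of the weight put into each
  factor.\<close>

lemma weighted_Cauchy_Schwarz_double_sum:
  fixes a p q :: "'n::finite \<Rightarrow> 'n \<Rightarrow> real"
  assumes "\<And>i j. 0 \<le> a i j"
  shows "(\<Sum>i\<in>UNIV. \<Sum>j\<in>UNIV. a i j * (p i j * q i j))\<^sup>2
    \<le> (\<Sum>i\<in>UNIV. \<Sum>j\<in>UNIV. a i j * (p i j)\<^sup>2) * (\<Sum>i\<in>UNIV. \<Sum>j\<in>UNIV. a i j * (q i j)\<^sup>2)"
proof -
  let ?s = "\<lambda>i j. sqrt (a i j)"
  have s: "?s i j * ?s i j = a i j" for i j using assms by simp
  have pq: "?s i j * p i j * (?s i j * q i j) = a i j * (p i j * q i j)" for i j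
    by (metis (no_types, lifting) s mult.assoc mult.left_commute)
  have "(\<Sum>z\<in>UNIV \<times> UNIV. (?s (fst z) (snd z) * p (fst z) (snd z)) * (?s (fst z) (snd z) * q (fst z) (snd z)))\<^sup>2
    \<le> (\<Sum>z\<in>UNIV \<times> UNIV. (?s (fst z) (snd z) * p (fst z) (snd z))\<^sup>2)
      * (\<Sum>z\<in>UNIV \<times> UNIV. (?s (fst z) (snd z) * q (fst z) (snd z))\<^sup>2)"
    by (rule Cauchy_Schwarz_ineq_sum)
  then show ?thesis
    unfolding sum.cartesian_product' pq using assms by (simp add: power_mult_distrib)
qed

text \<open>The set is a minimizer of the expansion among all nonempty subsets of \<open>U\<close>.
  Its expansion \<open>h\<close> then bounds every cut inside \<open>U\<close> from below, as the
  co-area inequality requires.\<close>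

lemma dirichlet_cheeger:
  fixes G :: "'n::finite wgraph"
  assumes G: "weighted_graph G" "\<forall>x. pot G x \<ge> 0" and good: "dirichlet_le (laplacian G) c U"
  obtains S where "S \<noteq> {}" "S \<subseteq> U" "expansion G S \<le> sqrt (2 * max_wdegree G * c)"
proof -
  let ?a = "edge_weight G"
  have "finite {S. S \<subseteq> U \<and> S \<noteq> {}}" "{S. S \<subseteq> U \<and> S \<noteq> {}} \<noteq> {}"
    using dirichlet_le_nonempty[OF good] by auto
  from ex_is_arg_min_if_finite[OF this, of "expansion G"]
  obtain S where S: "S \<subseteq> U" "S \<noteq> {}" and min: "\<And>T. T \<subseteq> U \<Longrightarrow> T \<noteq> {} \<Longrightarrow> expansion G S \<le> expansion G T"
    unfolding is_arg_min_linorder by blast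
  define h where "h = expansion G S"
  have h: "h \<ge> 0"
    unfolding h_def expansion_edge_weight by (simp add: sum_nonneg edge_weight_nonneg G)
  have cut: "h * real (card T) \<le> (\<Sum>i\<in>T. \<Sum>j\<in>- T. ?a i j)" if "T \<subseteq> U" "T \<noteq> {}" for T
  proof -
    have "real (card T) > 0" using that by (simp add: card_gt_0_iff)
    then show ?thesis
      using min[OF that] by (simp add: h_def expansion_edge_weight[of G T] pos_le_divide_eq)
  qed
  obtain f where f: "f \<noteq> 0" "\<And>i. i \<notin> U \<Longrightarrow> f $ i = 0" "f \<bullet> (laplacian G *v f) \<le> c * (f \<bullet> f)"
    using good unfolding dirichlet_le_def by blast
  define N where "N = f \<bullet> f"
  have N: "N > 0" using f(1) by (simp add: N_def)
  have NS: "N = (\<Sum>i\<in>UNIV. (f $ i)\<^sup>2)" by (simp add: N_def inner_vec_def power2_eq_square)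
  let ?E = "\<Sum>i\<in>UNIV. \<Sum>j\<in>UNIV. ?a i j * \<bar>f $ i - f $ j\<bar>\<^sup>2"
  let ?F = "\<Sum>i\<in>UNIV. \<Sum>j\<in>UNIV. ?a i j * \<bar>f $ i + f $ j\<bar>\<^sup>2"
  \<comment> \<open>The co-area inequality is applied to the square of \<open>f\<close>, which is
    nonnegative and vanishes off \<open>U\<close>.\<close>
  have "2 * h * N \<le> (\<Sum>i\<in>UNIV. \<Sum>j\<in>UNIV. ?a i j * \<bar>(f $ i)\<^sup>2 - (f $ j)\<^sup>2\<bar>)"
    unfolding NS
    by (rule coarea_lower_bound[OF edge_weight_commute[OF G(1)] cut]) (use f(2) in auto)
  also have "\<dots> = (\<Sum>i\<in>UNIV. \<Sum>j\<in>UNIV. ?a i j * (\<bar>f $ i - f $ j\<bar> * \<bar>f $ i + f $ j\<bar>))"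
    by (simp add: power2_eq_square square_diff_square_factored abs_mult mult.commute)
  finally have "(2 * h * N)\<^sup>2 \<le> (\<Sum>i\<in>UNIV. \<Sum>j\<in>UNIV. ?a i j * (\<bar>f $ i - f $ j\<bar> * \<bar>f $ i + f $ j\<bar>))\<^sup>2"
    using h N by (intro power_mono) auto
  also have "\<dots> \<le> ?E * ?F"
    by (rule weighted_Cauchy_Schwarz_double_sum[OF edge_weight_nonneg[OF G(1)]])
  \<comment> \<open>The first factor bounds the energy by the test inequality, the second comes from
    comparing the square of a sum with twice the sum of squares. Cancelling
    \<open>4 * N\<^sup>2\<close> leaves the claimed constant 2.\<close>
  also have "\<dots> \<le> (2 * (c * N)) * (4 * (max_wdegree G * N))"
  proof (rule mult_mono)
    show E: "?E \<le> 2 * (c * N)"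
      using laplacian_form_ge_dirichlet_energy[OF G, of f] f(3) by (simp add: N_def)
    show "0 \<le> ?F"
      by (intro sum_nonneg mult_nonneg_nonneg edge_weight_nonneg G(1)) auto
    have "0 \<le> ?E"
      by (intro sum_nonneg mult_nonneg_nonneg edge_weight_nonneg G(1)) auto
    with E show "0 \<le> 2 * (c * N)" by linarith
    have sq: "\<bar>x + y\<bar>\<^sup>2 \<le> 2 * x\<^sup>2 + 2 * y\<^sup>2" for x y :: real
      using sum_squares_bound[of x y] by (simp add: power2_sum)
    have "?F \<le> (\<Sum>i\<in>UNIV. \<Sum>j\<in>UNIV. ?a i j * (2 * (f $ i)\<^sup>2 + 2 * (f $ j)\<^sup>2))"
      by (intro sum_mono mult_left_mono sq edge_weight_nonneg G(1))
    also have "\<dots> = 2 * (\<Sum>i\<in>UNIV. \<Sum>j\<in>UNIV. ?a i j * (f $ i)\<^sup>2) + 2 * (\<Sum>i\<in>UNIV. \<Sum>j\<in>UNIV. ?a i j * (f $ j)\<^sup>2)"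
      by (simp add: distrib_left sum.distrib sum_distrib_left ac_simps)
    also have "(\<Sum>i\<in>UNIV. \<Sum>j\<in>UNIV. ?a i j * (f $ j)\<^sup>2) = (\<Sum>i\<in>UNIV. \<Sum>j\<in>UNIV. ?a i j * (f $ i)\<^sup>2)"
      by (subst sum.swap) (simp add: edge_weight_commute[OF G(1)])
    also have "(\<Sum>i\<in>UNIV. \<Sum>j\<in>UNIV. ?a i j * (f $ i)\<^sup>2) = (\<Sum>i\<in>UNIV. wdegree G i * (f $ i)\<^sup>2)"
      by (simp add: wdegree_edge_weight sum_distrib_right)
    also have "\<dots> \<le> (\<Sum>i\<in>UNIV. max_wdegree G * (f $ i)\<^sup>2)"
      by (intro sum_mono mult_right_mono wdegree_le_max) auto
    also have "\<dots> = max_wdegree G * N" by (simp add: NS sum_distrib_left)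
    finally show "?F \<le> 4 * (max_wdegree G * N)" by (simp add: mult.commute)
  qed
  finally have "(4 * N\<^sup>2) * h\<^sup>2 \<le> (4 * N\<^sup>2) * (2 * max_wdegree G * c)"
    by (simp add: power2_eq_square ac_simps)
  then have "h\<^sup>2 \<le> 2 * max_wdegree G * c" using N by (simp add: ac_simps)
  then have "h \<le> sqrt (2 * max_wdegree G * c)" by (rule real_le_rsqrt)
  with S that show thesis by (simp add: h_def)
qed

section \<open>From eigenvalues of a tree to disjoint sets of small expansion\<close>

section \<open>Trees\<close>

text \<open>Eigenvalue number \<open>p\<close> sits at list position \<open>p - 1\<close>, which
  turns the weak and strict bounds of the list into strict and weak ones here.\<close>

lemma laplace_eigenvalue_counts:
  fixes G :: "'n::finite wgraph"
  assumes "orthonormal_eigenbasis (laplacian G) v l" "1 \<le> p" "p \<le> CARD('n)"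
  shows "laplace_eigenvalue G p \<in> range l"
    and "card {i. l i < laplace_eigenvalue G p} < p"
    and "p \<le> card {i. l i \<le> laplace_eigenvalue G p}"
proof -
  have "p - 1 < CARD('n)" using assms(2,3) by linarith
  note counts = sorted_list_of_multiset_nth_counts[where l = l, OF this]
  have e: "laplace_eigenvalue G p = sorted_list_of_multiset (image_mset l (mset_set UNIV)) ! (p - 1)"
    by (simp add: laplace_eigenvalue_def eigenvalue_list_orthonormal_eigenbasis[OF assms(1)])
  show "laplace_eigenvalue G p \<in> range l" unfolding e by (rule counts(1))
  show "card {i. l i < laplace_eigenvalue G p} < p" unfolding e using counts(2) assms(2) by linarith
  show "p \<le> card {i. l i \<le> laplace_eigenvalue G p}" unfolding e using counts(3) assms(2) by linarith
qed

lemma laplace_eigenvalue_top: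
  fixes G :: "'n::finite wgraph"
  assumes "orthonormal_eigenbasis (laplacian G) v l"
  shows "l i \<le> laplace_eigenvalue G CARD('n)"
proof -
  have "card {i. l i \<le> laplace_eigenvalue G CARD('n)} = CARD('n)"
  proof (rule antisym)
    show "CARD('n) \<le> card {i. l i \<le> laplace_eigenvalue G CARD('n)}"
      by (rule laplace_eigenvalue_counts(3)[OF assms]) (simp_all add: Suc_le_eq)
  qed (simp add: card_mono)
  then have "{i. l i \<le> laplace_eigenvalue G CARD('n)} = UNIV"
    by (intro card_subset_eq) auto
  then show ?thesis by blast
qed

lemma laplacian_eigenvalue_nonneg:
  assumes "weighted_graph G" "\<forall>x. pot G x \<ge> 0" "orthonormal_eigenbasis (laplacian G) v l"
  shows "0 \<le> l i"
  using laplacian_form_nonneg[OF assms(1,2), of "v i"] assms(3)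
  by (simp add: orthonormal_eigenbasis_def)

text \<open>The eigenvectors with eigenvalue at most the \<open>p\<close>-th span a space of
  dimension at least \<open>p\<close>, possibly more under multiplicity.
  \<open>acyclic_disjoint_dirichlet_le\<close> splits it into \<open>p\<close> pieces, and
  \<open>dirichlet_cheeger\<close> shrinks each piece to a set of small expansion.\<close>

lemma tree_cheeger:
  fixes G :: "'n::finite wgraph"
  assumes tree: "weighted_tree G" and pot: "\<forall>x. pot G x \<ge> 0" and p: "1 \<le> p" "p \<le> CARD('n)"
  obtains A :: "nat \<Rightarrow> 'n set" where "disjoint_family_on A {..<p}" "\<And>i. i < p \<Longrightarrow> A i \<noteq> {}"
    "\<And>i. i < p \<Longrightarrow> expansion G (A i) \<le> sqrt (2 * max_wdegree G * laplace_eigenvalue G p)"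
proof -
  let ?L = "laplacian G" and ?c = "laplace_eigenvalue G p"
  have G: "weighted_graph G" and acyc: "\<nexists>c. graph_cycle G c"
    using tree by (simp_all add: weighted_tree_def)
  note sym = laplacian_symmetric[OF G]
  obtain v l where vl: "orthonormal_eigenbasis ?L v l" using symmetric_matrix_eigenbasis[OF sym] by blast
  have on: "v i \<bullet> v j = (if i = j then 1 else 0)" for i j
    using vl by (simp add: orthonormal_eigenbasis_def)
  let ?I = "{i. l i \<le> ?c}"
  have "inj v" by (rule injI) (metis on zero_neq_one)
  then have cardI: "card (v ` ?I) = card ?I" by (meson card_image inj_on_subset subset_UNIV)
  have "independent (v ` ?I)"
  proof (rule pairwise_orthogonal_independent)
    show "pairwise orthogonal (v ` ?I)" by (auto simp: pairwise_def orthogonal_def on)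
    show "0 \<notin> v ` ?I" by (metis (no_types, lifting) imageE inner_zero_left on zero_neq_one)
  qed
  then have "dim (span (v ` ?I)) = card ?I" using cardI by (simp add: dim_eq_card_independent)
  then have dimW: "p \<le> dim (span (v ` ?I))" using laplace_eigenvalue_counts(3)[OF vl p] by simp
  have "f \<bullet> (?L *v f) \<le> ?c * (f \<bullet> f)" if f: "f \<in> span (v ` ?I)" for f
  proof -
    have "subspace {f. \<forall>j. j \<notin> ?I \<longrightarrow> v j \<bullet> f = 0}"
      by (auto simp: subspace_def inner_add_right)
    moreover have "v ` ?I \<subseteq> {f. \<forall>j. j \<notin> ?I \<longrightarrow> v j \<bullet> f = 0}" by (auto simp: on)
    ultimately have f0: "v j \<bullet> f = 0" if "j \<notin> ?I" for j
      using span_minimal[of "v ` ?I"] f that by blast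
    \<comment> \<open>Coefficients belonging to larger eigenvalues vanish on the span, so the
      comparison holds term by term.\<close>
    have "l j * (v j \<bullet> f)\<^sup>2 \<le> ?c * (v j \<bullet> f)\<^sup>2" for j
      using f0[of j] by (cases "j \<in> ?I") (auto intro: mult_right_mono)
    then show ?thesis
      unfolding orthonormal_eigenbasis_form[OF vl] orthonormal_eigenbasis_norm[OF vl, of f] sum_distrib_left
      by (intro sum_mono)
  qed
  moreover have "?L $ i $ j = 0" if "i \<noteq> j" "\<not> adj G i j" for i j
    using that by (simp add: laplacian_nth edge_weight_def)
  moreover have "symp (adj G)" using G by (simp add: weighted_graph_def)
  ultimately obtain A :: "nat \<Rightarrow> 'n set"
    where A: "\<forall>i<p. dirichlet_le ?L ?c (A i)" "disjoint_family_on A {..<p}"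
    using acyclic_disjoint_dirichlet_le[OF sym, of G "span (v ` ?I)" p UNIV ?c] acyc dimW by auto
  have "\<exists>S. S \<noteq> {} \<and> S \<subseteq> A i \<and> expansion G S \<le> sqrt (2 * max_wdegree G * ?c)" if "i < p" for i
    by (rule dirichlet_cheeger[OF G pot, of ?c "A i"]) (use A(1) that in blast)+
  then obtain S where S: "\<And>i. i < p \<Longrightarrow> S i \<noteq> {} \<and> S i \<subseteq> A i \<and>
      expansion G (S i) \<le> sqrt (2 * max_wdegree G * ?c)"
    by metis
  then have "disjoint_family_on S {..<p}"
    using A(2) unfolding disjoint_family_on_def by blast
  with S that show thesis by blast
qed

section \<open>Expansion and spectrum of Cartesian products\<close>

section \<open>Products\<close>

lemma sum_UNIV_prod:
  fixes f :: "'a::finite \<times> 'b::finite \<Rightarrow> 'c::comm_monoid_add"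
  shows "(\<Sum>z\<in>UNIV. f z) = (\<Sum>x\<in>UNIV. \<Sum>y\<in>UNIV. f (x, y))"
  unfolding UNIV_Times_UNIV[symmetric] sum.cartesian_product by (simp add: case_prod_unfold)

text \<open>The summands never overlap: where both conditions hold the vertices coincide, and
  neither graph has loops.\<close>

lemma edge_weight_product_graph:
  assumes "weighted_graph G1" "weighted_graph G2"
  shows "edge_weight (product_graph G1 G2) (x, y) (x', y') =
    (if x' = x then edge_weight G2 y y' else 0) + (if y' = y then edge_weight G1 x x' else 0)"
  using edge_weight_self[OF assms(1)] edge_weight_self[OF assms(2)] assms
  by (auto simp: edge_weight_def product_graph_def weighted_graph_def dest: irreflpD)

lemma wdegree_product_graph:
  assumes "weighted_graph G1" "weighted_graph G2"
  shows "wdegree (product_graph G1 G2) (x, y) = wdegree G1 x + wdegree G2 y"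
proof -
  have "wdegree (product_graph G1 G2) (x, y) =
      (\<Sum>x'\<in>UNIV. \<Sum>y'\<in>UNIV. edge_weight (product_graph G1 G2) (x, y) (x', y'))"
    by (simp add: wdegree_edge_weight sum_UNIV_prod)
  also have "\<dots> = (\<Sum>x'\<in>UNIV. (if x' = x then wdegree G2 y else 0) + edge_weight G1 x x')"
    by (intro sum.cong refl)
      (simp add: edge_weight_product_graph[OF assms] sum.distrib wdegree_edge_weight)
  finally show ?thesis by (simp add: sum.distrib wdegree_edge_weight)
qed

lemma max_wdegree_product_graph:
  assumes "weighted_graph G1" "weighted_graph G2"
  shows "max_wdegree G1 + max_wdegree G2 \<le> max_wdegree (product_graph G1 G2)"
proof -
  obtain x y where "max_wdegree G1 = wdegree G1 x" "max_wdegree G2 = wdegree G2 y"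
    using max_wdegree_attained by metis
  then show ?thesis
    using wdegree_le_max[of "product_graph G1 G2" "(x, y)"] by (simp add: wdegree_product_graph[OF assms])
qed

text \<open>The set meets each fibre over \<open>S\<close> in a single vertex, so all
  \<open>G2\<close>-edges there leave it, besides the \<open>G1\<close>-edges leaving
  \<open>S\<close>.\<close>

lemma expansion_product_graph_Times_singleton:
  assumes "weighted_graph G1" "weighted_graph G2" "S \<noteq> {}"
  shows "expansion (product_graph G1 G2) (S \<times> {y}) = expansion G1 S + wdegree G2 y"
proof -
  let ?w = "edge_weight (product_graph G1 G2)"
  have row: "(\<Sum>z\<in>- (S \<times> {y}). ?w (x, y) z) = wdegree G2 y + (\<Sum>x'\<in>- S. edge_weight G1 x x')"
    if x: "x \<in> S" for x
  proof -
    have "(\<Sum>z\<in>- (S \<times> {y}). ?w (x, y) z) = (\<Sum>z\<in>UNIV. if z \<in> S \<times> {y} then 0 else ?w (x, y) z)"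
      by (simp add: sum.If_cases)
    also have "\<dots> = (\<Sum>x'\<in>UNIV. \<Sum>y'\<in>UNIV. if x' \<in> S \<and> y' = y then 0 else ?w (x, y) (x', y'))"
      by (simp add: sum_UNIV_prod)
    also have "\<dots> = (\<Sum>x'\<in>UNIV. \<Sum>y'\<in>UNIV. (if x' = x then edge_weight G2 y y' else 0)
        + (if y' = y then if x' \<in> S then 0 else edge_weight G1 x x' else 0))"
      using x edge_weight_self[OF assms(2)]
      by (intro sum.cong refl) (auto simp: edge_weight_product_graph[OF assms(1,2)])
    also have "\<dots> = (\<Sum>x'\<in>UNIV. (if x' = x then wdegree G2 y else 0)
        + (if x' \<in> S then 0 else edge_weight G1 x x'))"
      by (intro sum.cong refl) (simp add: sum.distrib wdegree_edge_weight)
    also have "\<dots> = wdegree G2 y + (\<Sum>x'\<in>- S. edge_weight G1 x x')"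
      by (simp add: sum.distrib sum.If_cases)
    finally show ?thesis .
  qed
  have "(\<Sum>z\<in>S \<times> {y}. \<Sum>z'\<in>- (S \<times> {y}). ?w z z') = (\<Sum>x\<in>S. \<Sum>z'\<in>- (S \<times> {y}). ?w (x, y) z')"
    by (simp add: sum.cartesian_product' case_prod_unfold)
  also have "\<dots> = (\<Sum>x\<in>S. wdegree G2 y + (\<Sum>x'\<in>- S. edge_weight G1 x x'))"
    by (rule sum.cong) (simp_all add: row)
  also have "\<dots> = real (card S) * wdegree G2 y + (\<Sum>x\<in>S. \<Sum>x'\<in>- S. edge_weight G1 x x')"
    by (simp add: sum.distrib)
  finally have "(\<Sum>z\<in>S \<times> {y}. \<Sum>z'\<in>- (S \<times> {y}). ?w z z') =
      real (card S) * wdegree G2 y + (\<Sum>x\<in>S. \<Sum>x'\<in>- S. edge_weight G1 x x')" .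
  moreover have "card S > 0" using assms(3) by (simp add: card_gt_0_iff)
  ultimately show ?thesis
    using assms(3)
    by (simp add: expansion_edge_weight card_cartesian_product add_divide_distrib add.commute)
qed

text \<open>The Laplacian of the product is the Kronecker sum of the two Laplacians, as degrees and
  potentials add.\<close>

lemma laplacian_product_graph_nth:
  assumes "weighted_graph G1" "weighted_graph G2"
  shows "laplacian (product_graph G1 G2) $ (x, y) $ (x', y') =
    (if x' = x then laplacian G2 $ y $ y' else 0) + (if y' = y then laplacian G1 $ x $ x' else 0)"
  using edge_weight_self[OF assms(1)] edge_weight_self[OF assms(2)]
  by (auto simp: laplacian_nth edge_weight_product_graph[OF assms] wdegree_product_graph[OF assms])
     (auto simp: product_graph_def)

text \<open>Tensor products of eigenvectors diagonalize a Kronecker sum. They already form a full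
  basis, so the pairwise sums are all eigenvalues with multiplicity.\<close>

lemma orthonormal_eigenbasis_product_graph:
  fixes G1 :: "'a::finite wgraph" and G2 :: "'b::finite wgraph"
  assumes G: "weighted_graph G1" "weighted_graph G2"
    and 1: "orthonormal_eigenbasis (laplacian G1) v l"
    and 2: "orthonormal_eigenbasis (laplacian G2) u m"
  shows "orthonormal_eigenbasis (laplacian (product_graph G1 G2))
    (\<lambda>(i, j). \<chi> z. v i $ fst z * u j $ snd z) (\<lambda>(i, j). l i + m j)"
proof -
  define t where "t i j = (\<chi> z. v i $ fst z * u j $ snd z)" for i j
  have t: "(\<lambda>(i, j). \<chi> z. v i $ fst z * u j $ snd z) = (\<lambda>(i, j). t i j)"
    by (simp add: t_def case_prod_unfold)
  let ?L = "laplacian (product_graph G1 G2)"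
  have "t i j \<bullet> t i' j' = (v i \<bullet> v i') * (u j \<bullet> u j')" for i j i' j'
    by (simp add: t_def inner_vec_def sum_UNIV_prod sum_product ac_simps)
  moreover have "(?L *v t i j) $ (x, y) = (l i + m j) * t i j $ (x, y)" for i j x y
  proof -
    have v: "(\<Sum>x'\<in>UNIV. laplacian G1 $ x $ x' * v i $ x') = l i * v i $ x"
      using 1 by (simp add: orthonormal_eigenbasis_def vec_eq_iff matrix_vector_mult_def)
    have u: "(\<Sum>y'\<in>UNIV. laplacian G2 $ y $ y' * u j $ y') = m j * u j $ y"
      using 2 by (simp add: orthonormal_eigenbasis_def vec_eq_iff matrix_vector_mult_def)
    have entry: "?L $ (x, y) $ (x', y') * t i j $ (x', y') =
        (if x' = x then v i $ x * (laplacian G2 $ y $ y' * u j $ y') else 0)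
        + (if y' = y then (laplacian G1 $ x $ x' * v i $ x') * u j $ y else 0)" for x' y'
      unfolding laplacian_product_graph_nth[OF G]
      by (cases "x' = x"; cases "y' = y"; simp add: t_def algebra_simps)
    have "(?L *v t i j) $ (x, y) = (\<Sum>x'\<in>UNIV. \<Sum>y'\<in>UNIV.
        (if x' = x then v i $ x * (laplacian G2 $ y $ y' * u j $ y') else 0)
        + (if y' = y then (laplacian G1 $ x $ x' * v i $ x') * u j $ y else 0))"
      unfolding matrix_vector_mult_def vec_lambda_beta sum_UNIV_prod entry ..
    also have "\<dots> = (\<Sum>x'\<in>UNIV. (if x' = x then v i $ x * (m j * u j $ y) else 0)
        + (laplacian G1 $ x $ x' * v i $ x') * u j $ y)"
      by (intro sum.cong refl) (simp add: sum.distrib flip: u sum_distrib_left)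
    also have "\<dots> = v i $ x * (m j * u j $ y) + l i * v i $ x * u j $ y"
      by (simp add: sum.distrib flip: v sum_distrib_right)
    finally show ?thesis by (simp add: t_def algebra_simps)
  qed
  then have "?L *v t i j = (l i + m j) *\<^sub>R t i j" for i j
    by (simp add: vec_eq_iff split_paired_all)
  ultimately show ?thesis
    using 1 2 unfolding t by (auto simp: orthonormal_eigenbasis_def)
qed

text \<open>
  The gap condition confines every pair of eigenvalues with sum below
  \<open>\<lambda>\<^sub>k\<^sup>(\<^sup>1\<^sup>) + \<lambda>\<^sub>n\<^sup>(\<^sup>2\<^sup>)\<close> to the first \<open>k\<close> eigenvalues of \<open>G1\<close>.
\<close>

lemma laplace_eigenvalue_product_graph_ge:
  fixes G1 :: "'a::finite wgraph" and G2 :: "'b::finite wgraph"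
  assumes G: "weighted_graph G1" "weighted_graph G2" and pot: "\<forall>y. pot G2 y \<ge> 0"
    and k: "1 \<le> k" "k < CARD('a)"
    and gap: "laplace_eigenvalue G2 CARD('b) < laplace_eigenvalue G1 (k + 1) - laplace_eigenvalue G1 k"
  shows "laplace_eigenvalue G1 k + laplace_eigenvalue G2 CARD('b)
    \<le> laplace_eigenvalue (product_graph G1 G2) (k * CARD('b))"
proof (rule ccontr)
  let ?c = "laplace_eigenvalue G1 k" and ?d = "laplace_eigenvalue G1 (k + 1)"
    and ?M = "laplace_eigenvalue G2 CARD('b)" and ?e = "laplace_eigenvalue (product_graph G1 G2) (k * CARD('b))"
  assume "\<not> ?c + ?M \<le> ?e"
  then have less: "?e < ?c + ?M" by simp
  obtain v l where 1: "orthonormal_eigenbasis (laplacian G1) v l"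
    using symmetric_matrix_eigenbasis[OF laplacian_symmetric[OF G(1)]] by blast
  obtain u m where 2: "orthonormal_eigenbasis (laplacian G2) u m"
    using symmetric_matrix_eigenbasis[OF laplacian_symmetric[OF G(2)]] by blast
  note 3 = orthonormal_eigenbasis_product_graph[OF G 1 2]
  have m0: "0 \<le> m j" for j by (rule laplacian_eigenvalue_nonneg[OF G(2) pot 2])
  obtain i where i: "?c = l i" using laplace_eigenvalue_counts(1)[OF 1, of k] k by auto
  obtain j where j: "?M = m j" using laplace_eigenvalue_counts(1)[OF 2, of "CARD('b)"] by (auto simp: Suc_le_eq)
  let ?P = "{i. l i < ?d} \<times> (UNIV :: 'b set)"
  let ?Q = "{z. (case z of (i, j) \<Rightarrow> l i + m j) \<le> ?e}"
  have "?Q \<subseteq> ?P"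
  proof
    fix z assume z: "z \<in> ?Q"
    then have "l (fst z) + m (snd z) \<le> ?e" by (simp add: case_prod_unfold)
    with m0[of "snd z"] less gap have "l (fst z) < ?d" by linarith
    then show "z \<in> ?P" by (simp add: mem_Times_iff)
  qed
  \<comment> \<open>The pair realizing \<open>?c\<close> and \<open>?M\<close> separates the two
    sets; without this strictness the counts would not contradict each other.\<close>
  moreover have "(i, j) \<in> ?P" using i j m0[of j] gap by simp
  moreover have "(i, j) \<notin> ?Q" using i j less by simp
  ultimately have "card ?Q < card ?P" by (intro psubset_card_mono) auto
  also have "card ?P \<le> k * CARD('b)"
    using laplace_eigenvalue_counts(2)[OF 1, of "k + 1"] k by (simp add: card_cartesian_product)
  also have "k * CARD('b) \<le> card ?Q"
    using laplace_eigenvalue_counts(3)[OF 3, of "k * CARD('b)"] k by (simp add: Suc_le_eq)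
  finally show False by simp
qed

text \<open>The Rayleigh quotient at a standard basis vector is a diagonal entry, here degree plus
  potential.\<close>

lemma max_wdegree_le_top_eigenvalue:
  fixes G :: "'n::finite wgraph"
  assumes G: "weighted_graph G" and pot: "\<forall>x. pot G x \<ge> 0"
  shows "max_wdegree G \<le> laplace_eigenvalue G CARD('n)"
proof -
  let ?M = "laplace_eigenvalue G CARD('n)"
  obtain v l where vl: "orthonormal_eigenbasis (laplacian G) v l"
    using symmetric_matrix_eigenbasis[OF laplacian_symmetric[OF G]] by blast
  obtain x where x: "max_wdegree G = wdegree G x" by (rule max_wdegree_attained)
  let ?e = "axis x 1 :: real^'n"
  have "?e \<bullet> (laplacian G *v ?e) = wdegree G x + pot G x"
    by (simp add: inner_axis' matrix_vector_mult_basis column_def laplacian_nth edge_weight_self[OF G])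
  then have "wdegree G x \<le> ?e \<bullet> (laplacian G *v ?e)" using pot by simp
  also have "\<dots> \<le> ?M * (?e \<bullet> ?e)"
    unfolding orthonormal_eigenbasis_form[OF vl] orthonormal_eigenbasis_norm[OF vl, of ?e] sum_distrib_left
    by (intro sum_mono mult_right_mono laplace_eigenvalue_top[OF vl]) auto
  finally show ?thesis by (simp add: x inner_axis_axis)
qed

text \<open>\<open>Min\<close> is informative only on finite sets. The tuples are functions on all
  of \<open>nat\<close>, but their maxima are values of \<open>expansion G\<close>, of which there
  are finitely many.\<close>

lemma multiway_cheeger_le:
  fixes G :: "'n::finite wgraph"
  assumes "1 \<le> m" "disjoint_family_on A {1..m}" "\<And>i. i \<in> {1..m} \<Longrightarrow> A i \<noteq> {}"
    and "\<And>i. i \<in> {1..m} \<Longrightarrow> expansion G (A i) \<le> c"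
  shows "multiway_cheeger m G \<le> c"
proof -
  let ?X = "{Max ((\<lambda>i. expansion G (A i)) ` {1..m}) | A :: nat \<Rightarrow> 'n set.
            (\<forall>i\<in>{1..m}. A i \<noteq> {}) \<and> disjoint_family_on A {1..m}}"
  have "?X \<subseteq> range (expansion G)"
  proof
    fix z assume "z \<in> ?X"
    then obtain A :: "nat \<Rightarrow> 'n set" where "z = Max ((\<lambda>i. expansion G (A i)) ` {1..m})" by blast
    then have "z \<in> (\<lambda>i. expansion G (A i)) ` {1..m}" using assms(1) by (simp only:, intro Max_in) auto
    then show "z \<in> range (expansion G)" by blast
  qed
  then have "finite ?X" by (rule finite_subset) simp
  then have "multiway_cheeger m G \<le> Max ((\<lambda>i. expansion G (A i)) ` {1..m})"
    unfolding multiway_cheeger_def using assms(2,3) by (intro Min_le) blast+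
  also have "\<dots> \<le> c" using assms(1,4) by simp
  finally show ?thesis .
qed

text \<open>In the application \<open>s\<close> and \<open>t\<close> are the maximal degrees,
  \<open>l\<close> is the \<open>k\<close>-th eigenvalue of the tree and \<open>M\<close> the top
  eigenvalue of the other factor.\<close>

lemma sqrt_add_le_sqrt_product:
  fixes s t l M :: real
  assumes "0 \<le> s" "0 \<le> t" "0 \<le> l" "t \<le> M"
  shows "sqrt (2 * s * l) + t \<le> sqrt (2 * (s + t) * (l + M))"
proof (rule real_le_rsqrt)
  let ?a = "sqrt (2 * s * l)"
  have a: "?a\<^sup>2 = 2 * s * l" using assms by simp
  \<comment> \<open>This controls the cross term after squaring, since \<open>2 * s * l\<close> is
    at most the square of \<open>s + l\<close>.\<close>
  have "?a \<le> s + l"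
    by (rule real_le_lsqrt) (use assms in \<open>auto simp: power2_sum\<close>)
  then have "2 * t * ?a \<le> 2 * t * (s + l)" using assms by (intro mult_left_mono) auto
  moreover have "s * t \<le> s * M" using assms by (intro mult_left_mono) auto
  moreover have "t * t \<le> 2 * (t * M)"
    using mult_left_mono[OF assms(4,2)] mult_nonneg_nonneg[OF assms(2,2)] by linarith
  ultimately show "(?a + t)\<^sup>2 \<le> 2 * (s + t) * (l + M)"
    unfolding power2_sum a by (simp add: algebra_simps power2_eq_square)
qed

theorem theorem4p1:
  fixes G1 :: "'a::finite wgraph" and G2 :: "'b::finite wgraph" and k :: nat
  assumes "weighted_tree G1"
    and "weighted_bipartite_graph G2"
    and "\<forall>x. pot G1 x \<ge> 0"
    and "\<forall>y. pot G2 y \<ge> 0"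
    and "1 \<le> k" and "k \<le> CARD('a) - 1"
    and "laplace_eigenvalue G2 CARD('b) < laplace_eigenvalue G1 (k + 1) - laplace_eigenvalue G1 k"
  shows "multiway_cheeger (k * CARD('b)) (product_graph G1 G2)
           \<le> sqrt (2 * max_wdegree (product_graph G1 G2)
                    * laplace_eigenvalue (product_graph G1 G2) (k * CARD('b)))"
proof -
  let ?G = "product_graph G1 G2"
  let ?s = "max_wdegree G1" and ?t = "max_wdegree G2"
    and ?l = "laplace_eigenvalue G1 k" and ?M = "laplace_eigenvalue G2 CARD('b)"
  have G: "weighted_graph G1" "weighted_graph G2"
    using assms(1,2) by (simp_all add: weighted_tree_def weighted_bipartite_graph_def)
  have k: "k < CARD('a)" using assms(5,6) by linarith
  obtain A where A: "disjoint_family_on A {..<k}" "\<And>i. i < k \<Longrightarrow> A i \<noteq> {}"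
    "\<And>i. i < k \<Longrightarrow> expansion G1 (A i) \<le> sqrt (2 * ?s * ?l)"
    using tree_cheeger[OF assms(1,3,5)] k by (metis less_imp_le)
  have s: "0 \<le> ?s" and t: "0 \<le> ?t"
    using wdegree_nonneg[OF G(1)] wdegree_nonneg[OF G(2)] max_wdegree_attained by metis+
  have l: "0 \<le> ?l"
  proof -
    obtain v l where vl: "orthonormal_eigenbasis (laplacian G1) v l"
      using symmetric_matrix_eigenbasis[OF laplacian_symmetric[OF G(1)]] by blast
    then show ?thesis
      using laplace_eigenvalue_counts(1)[OF vl assms(5)] laplacian_eigenvalue_nonneg[OF G(1) assms(3) vl] k
      by auto
  qed
  have tM: "?t \<le> ?M" by (rule max_wdegree_le_top_eigenvalue[OF G(2) assms(4)])
  let ?R = "sqrt (2 * max_wdegree ?G * laplace_eigenvalue ?G (k * CARD('b)))"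
  have "sqrt (2 * ?s * ?l) + ?t \<le> sqrt (2 * (?s + ?t) * (?l + ?M))"
    by (rule sqrt_add_le_sqrt_product[OF s t l tM])
  also have "\<dots> \<le> ?R"
    using max_wdegree_product_graph[OF G] s t l tM
      laplace_eigenvalue_product_graph_ge[OF G assms(4,5) k assms(7)]
    by (intro real_sqrt_le_mono mult_mono) auto
  finally have bound: "sqrt (2 * ?s * ?l) + ?t \<le> ?R" .
  \<comment> \<open>The tuples in \<open>multiway_cheeger\<close> are numbered from 1;
    \<open>b\<close> renumbers them by pairs of a tree set, indexed from 0, and a vertex of
    \<open>G2\<close>.\<close>
  have "card {1..k * CARD('b)} = card ({..<k} \<times> (UNIV :: 'b set))"
    by (simp add: card_cartesian_product)
  then obtain b where b: "bij_betw b {1..k * CARD('b)} ({..<k} \<times> (UNIV :: 'b set))"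
    using finite_same_card_bij[of "{1..k * CARD('b)}" "{..<k} \<times> (UNIV :: 'b set)"] by auto
  have bk: "fst (b q) < k" if "q \<in> {1..k * CARD('b)}" for q
    using bij_betwE[OF b] that by (metis SigmaE fst_conv lessThan_iff)
  let ?B = "\<lambda>q. A (fst (b q)) \<times> {snd (b q)}"
  show ?thesis
  proof (rule multiway_cheeger_le)
    show "1 \<le> k * CARD('b)" using assms(5) by (simp add: Suc_le_eq)
    show "?B q \<noteq> {}" if "q \<in> {1..k * CARD('b)}" for q using A(2) bk[OF that] by simp
    show "disjoint_family_on ?B {1..k * CARD('b)}"
      unfolding disjoint_family_on_def
    proof (intro ballI impI)
      \<comment> \<open>Different pairs differ in the tree index, where the sets \<open>A\<close>
        are disjoint, or in the vertex of \<open>G2\<close>, where the fibres are.\<close>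
      fix q r assume qr: "q \<in> {1..k * CARD('b)}" "r \<in> {1..k * CARD('b)}" "q \<noteq> r"
      then have "b q \<noteq> b r" using b by (meson bij_betw_imp_inj_on inj_onD)
      then have "fst (b q) \<noteq> fst (b r) \<or> snd (b q) \<noteq> snd (b r)" by (simp add: prod_eq_iff)
      then show "?B q \<inter> ?B r = {}"
        using A(1) bk[OF qr(1)] bk[OF qr(2)] by (auto simp: disjoint_family_on_def)
    qed
    fix q assume q: "q \<in> {1..k * CARD('b)}"
    have "expansion ?G (?B q) = expansion G1 (A (fst (b q))) + wdegree G2 (snd (b q))"
      by (rule expansion_product_graph_Times_singleton[OF G A(2)[OF bk[OF q]]])
    also have "\<dots> \<le> sqrt (2 * ?s * ?l) + ?t"
      by (rule add_mono[OF A(3)[OF bk[OF q]] wdegree_le_max])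
    also note bound
    finally show "expansion ?G (?B q) \<le> ?R" .
  qed
qed

end
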